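(* Let $V=\mathbb{R}^d$ be equipped with a non-degenerate symmetric bilinear form $\langle-,-\rangle$, and let $k\ge d+2$. For weights $\pi_1,\dots,\pi_k>0$ with $\sum_i\pi_i=1$ and means $\mu_1,\dots,\mu_k\in V$, consider \[\rho(x)=\sum_{i=1}^k\frac{\pi_i}{\sqrt{(2\pi)^d}}\,e^{-\frac12\langle x-\mu_i,x-\mu_i\rangle},\] assumed to be a probability density on $V$. Let $x_1,x_2$ be drawn independently according to $\rho$, set $\Delta=\langle x_1-x_2,x_1-x_2\rangle$, and let $r(\Delta)$ be the probability distribution of $\Delta$. Then for generic means $\mu_1,\dots,\mu_k$ (i.e. for $(\mu_1,\dots,\mu_k)$ outside some proper Zariski-closed subset of $V^k$), $\rho$ is uniquely reconstructible from $r$ up to a symmetry of the bilinear form: if $\bar\rho$ is another probability density of the same form (same bilinear form, $k$ components, positive weights summing to $1$) with the same distribution $r$, then there is an affine isometry $g$ of $(V,\langle-,-\rangle)$, i.e. $g(x)=Ax+b$ with $A\in O(V)$ and $b\in V$, such that $\rho(x)=\bar\rho(g\cdot x)$ for all $x\in V$.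
   Context: $O(V)$ denotes the group of linear maps $A:V\to V$ with $\langle Au,Av\rangle=\langle u,v\rangle$ for all $u,v\in V$. *)

theory Defs
  imports "HOL-Analysis.Analysis" "HOL-Probability.Probability"
begin

definition bil :: "real^'d^'d \<Rightarrow> real^'d \<Rightarrow> real^'d \<Rightarrow> real" where
  "bil B u v = u \<bullet> (B *v v)"

definition nondegenerate :: "real^'d^'d \<Rightarrow> bool" where
  "nondegenerate B \<longleftrightarrow> (\<forall>u. (\<forall>v. bil B u v = 0) \<longrightarrow> u = 0)"

definition gmix :: "real^'d^'d \<Rightarrow> real^'k \<Rightarrow> real^'d^'k \<Rightarrow> real^'d \<Rightarrow> real" where
  "gmix B w mu x = (\<Sum>i\<in>UNIV. w $ i / sqrt ((2 * pi) ^ CARD('d))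
      * exp (- (1/2) * bil B (x - mu $ i) (x - mu $ i)))"

definition is_prob_density :: "('a::euclidean_space \<Rightarrow> real) \<Rightarrow> bool" where
  "is_prob_density f \<longleftrightarrow> (\<forall>x. 0 \<le> f x) \<and> f \<in> borel_measurable lborel
      \<and> (\<integral>\<^sup>+ x. ennreal (f x) \<partial>lborel) = 1"

definition delta_dist :: "real^'d^'d \<Rightarrow> (real^'d \<Rightarrow> real) \<Rightarrow> real measure" where
  "delta_dist B f = distr (density lborel (\<lambda>x. ennreal (f x)) \<Otimes>\<^sub>M density lborel (\<lambda>x. ennreal (f x)))
      borel (\<lambda>(x1, x2). bil B (x1 - x2) (x1 - x2))"

inductive_set poly_fns :: "(real^'d^'k \<Rightarrow> real) set" where
  const: "(\<lambda>_. c) \<in> poly_fns"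
| coord: "(\<lambda>m. m $ i $ j) \<in> poly_fns"
| add: "p \<in> poly_fns \<Longrightarrow> q \<in> poly_fns \<Longrightarrow> (\<lambda>m. p m + q m) \<in> poly_fns"
| mult: "p \<in> poly_fns \<Longrightarrow> q \<in> poly_fns \<Longrightarrow> (\<lambda>m. p m * q m) \<in> poly_fns"

definition zariski_closed :: "(real^'d^'k) set \<Rightarrow> bool" where
  "zariski_closed Z \<longleftrightarrow> (\<exists>P \<subseteq> poly_fns. Z = {m. \<forall>p\<in>P. p m = 0})"

end

theory Submission
  imports Defs "HOL-Computational_Algebra.Polynomial"
begin

text \<open>
  A density of this form forces \<open>B\<close> to be positive definite. Completing the square, the Laplace
  transform of \<open>r\<close> is, up to a factor not depending on weights and means, the exponential sum
  \<open>\<Sum> w\<^sub>i w\<^sub>j exp (- u |\<mu>\<^sub>i - \<mu>\<^sub>j|\<^sup>2)\<close> for \<open>u \<in> (0, 1/4)\<close>, so \<open>r\<close> determines the squared distances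
  together with the total weight at each of them. For generic means the distances are distinct
  and nonzero, hence a second solution has the same distances up to a permutation of the pairs.

  That such a permutation is induced by a permutation of the points is the theorem of Boutin and
  Kemper. Encode squared distances as a quadratic form on the vectors of zero sum; \<open>n\<close>-dimensional
  configurations give forms of rank at most \<open>n\<close>. If a permutation of the pairs preserves this
  bound for \<open>n = d < k - 1\<close>, a tangent space argument shows that it also preserves it for
  \<open>n = d - 1\<close>, and so on down to \<open>n = 1\<close>. There the configuration with one point moved away from
  the others yields a form of rank one supported on \<open>k - 1\<close> pairs, which is again a star.
  Every other permutation is excluded by a polynomial condition on the means.
\<close>

section \<open>Ranks of symmetric matrices\<close>

lemma inner_symmetric_matrix:
  fixes M :: "real^'n^'n"
  assumes "transpose M = M"
  shows "x \<bullet> (M *v y) = (M *v x) \<bullet> y"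
  by (metis assms dot_lmul_matrix vector_transpose_matrix)

lemma kernel_symmetric_matrix:
  fixes M :: "real^'n^'n"
  assumes "transpose M = M"
  shows "{y. M *v y = 0} = {y. \<forall>x\<in>range ((*v) M). orthogonal x y}"
proof -
  have "M *v y = 0 \<longleftrightarrow> (\<forall>x. (M *v x) \<bullet> y = 0)" for y
    by (metis inner_symmetric_matrix[OF assms] inner_eq_zero_iff inner_zero_right)
  then show ?thesis by (auto simp: orthogonal_def)
qed

lemma subspace_range_matrix: "subspace (range ((*v) (M :: real^'n^'m)))"
  by (simp add: linear_subspace_image)

lemma dim_kernel_symmetric_matrix:
  fixes M :: "real^'n^'n"
  assumes "transpose M = M"
  shows "dim {y. M *v y = 0} + rank M = CARD('n)"
  using dim_subspace_orthogonal_to_vectors[OF subspace_range_matrix[of M] subspace_UNIV]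
  by (simp add: kernel_symmetric_matrix[OF assms] rank_dim_range)

lemma rank_add_le:
  fixes M N :: "real^'n^'m"
  shows "rank (M + N) \<le> rank M + rank N"
proof -
  let ?S = "{x + y |x y. x \<in> range ((*v) M) \<and> y \<in> range ((*v) N)}"
  have "range ((*v) (M + N)) \<subseteq> ?S"
    by (auto simp: matrix_vector_mult_add_rdistrib)
  then have "rank (M + N) \<le> dim ?S"
    unfolding rank_dim_range by (rule dim_subset)
  also have "\<dots> \<le> rank M + rank N"
    using dim_sums_Int[OF subspace_range_matrix subspace_range_matrix, of M N]
    by (simp add: rank_dim_range)
  finally show ?thesis .
qed

text \<open>Adding the orthogonal projection onto the kernel of \<open>M\<close> makes \<open>M\<close> invertible, while
  a matrix of smaller rank cannot become invertible that way.\<close>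
lemma det_detects_rank:
  fixes M :: "real^'n^'n"
  assumes sym: "transpose M = M" and r: "d < rank M"
  shows "\<exists>C. det (M + C) \<noteq> 0 \<and> (\<forall>N. rank N \<le> d \<longrightarrow> det (N + C) = 0)"
proof -
  let ?K = "{y. M *v y = 0}"
  have subK: "subspace ?K"
    by (auto simp: subspace_def matrix_vector_right_distrib matrix_vector_mult_scaleR)
  have spK: "span ?K = ?K" using subK by (simp add: span_eq_iff)
  obtain B where B: "B \<subseteq> ?K" "pairwise orthogonal B" "\<And>x. x \<in> B \<Longrightarrow> norm x = 1"
      "independent B" "card B = dim ?K" "span B = ?K"
    using orthonormal_basis_subspace[OF subK] by metis
  have finB: "finite B" using B(4) by (rule independent_imp_finite)
  define f where "f x = (\<Sum>b\<in>B. (b \<bullet> x) *\<^sub>R b)" for x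
  have lin: "linear f"
    unfolding f_def
    by (intro linearI) (auto simp: inner_add_right scaleR_add_left sum.distrib scaleR_sum_right)
  define C where "C = matrix f"
  have Cf: "C *v x = f x" for x
    using matrix_works[of f] lin by (simp add: C_def linear_matrix_vector_mul_eq)
  have fK: "f x \<in> ?K" for x
    unfolding f_def by (rule subspace_sum[OF subK]) (use B(1) subspace_mul[OF subK] in blast)
  have rC: "rank C \<le> dim ?K"
    unfolding rank_dim_range using fK by (intro dim_subset) (auto simp: Cf)
  have "inj ((*v) (M + C))"
  proof (rule linear_injective_0[THEN iffD2])
    show "linear ((*v) (M + C))" by simp
    show "\<forall>x. (M + C) *v x = 0 \<longrightarrow> x = 0"
    proof (intro allI impI)
      fix x assume "(M + C) *v x = 0"
      then have e: "M *v x = - f x"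
        by (simp add: matrix_vector_mult_add_rdistrib Cf add_eq_0_iff2)
      \<comment> \<open>Kernel and range of a symmetric matrix are orthogonal, so the two opposite
        vectors \<open>M *v x\<close> and \<open>f x\<close> both vanish. Then \<open>x\<close> lies
        in the kernel and is orthogonal to its basis \<open>B\<close>.\<close>
      have "(M *v x) \<bullet> f x = 0"
        using fK[of x] by (metis (mono_tags, lifting) inner_symmetric_matrix[OF sym] inner_zero_right mem_Collect_eq)
      with e have f0: "f x = 0" by simp
      with e have "x \<in> ?K" by simp
      moreover have "b \<bullet> x = 0" if b: "b \<in> B" for b
      proof -
        have "b \<bullet> f x = (\<Sum>c\<in>B. (c \<bullet> x) * (b \<bullet> c))"
          by (simp add: f_def inner_sum_right)
        also have "\<dots> = (\<Sum>c\<in>B. if c = b then b \<bullet> x else 0)"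
        proof (rule sum.cong)
          fix c assume c: "c \<in> B"
          have "b \<bullet> b = 1" using B(3)[OF b] by (simp add: norm_eq_1)
          moreover have "c \<noteq> b \<Longrightarrow> b \<bullet> c = 0" using B(2) b c
            by (auto simp: pairwise_def orthogonal_def)
          ultimately show "(c \<bullet> x) * (b \<bullet> c) = (if c = b then b \<bullet> x else 0)" by auto
        qed simp
        also have "\<dots> = b \<bullet> x" using b finB by simp
        finally show ?thesis using f0 by simp
      qed
      ultimately have "x \<in> span B" "\<And>b. b \<in> B \<Longrightarrow> orthogonal x b"
        using B(6) by (auto simp: orthogonal_def inner_commute)
      then have "orthogonal x x" using orthogonal_to_span by blast
      then show "x = 0" by (simp add: orthogonal_self)
    qed
  qed
  then have "det (M + C) \<noteq> 0"
    by (metis det_eq_0_rank less_rank_noninjective)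
  moreover have "det (N + C) = 0" if "rank N \<le> d" for N
  proof -
    have "rank (N + C) \<le> rank N + rank C" by (rule rank_add_le)
    also have "\<dots> < rank M + dim ?K" using that r rC by linarith
    also have "\<dots> = CARD('n)" using dim_kernel_symmetric_matrix[OF sym] by simp
    finally show ?thesis by (simp add: det_eq_0_rank)
  qed
  ultimately show ?thesis by blast
qed

text \<open>The condition on \<open>N\<close> is the tangency of \<open>N\<close> to the variety of matrices of bounded rank.\<close>
lemma rank_perturbation:
  fixes M N :: "real^'n^'n"
  assumes sym: "transpose M = M" and Mz: "M *v z = 0"
    and rk: "\<And>t. t > 0 \<Longrightarrow> rank (M + t *\<^sub>R N) \<le> rank M"
  shows "z \<bullet> (N *v z) = 0"
proof (cases "z = 0")
  case False
  let ?W = "range ((*v) M)"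
  have subW: "subspace ?W" by (rule subspace_range_matrix)
  have zW: "z \<bullet> w = 0" if "w \<in> ?W" for w
    using that Mz by (auto simp: inner_symmetric_matrix[OF sym])
  have "z \<notin> ?W" using zW[of z] False by auto
  then have dimV: "dim (insert z ?W) = rank M + 1"
    using subW by (simp add: dim_insert rank_dim_range span_eq_iff[THEN iffD2])
  have "x = 0" if x: "x \<in> ?W" and "M *v x = 0" for x
  proof -
    obtain y where y: "x = M *v y" using x by auto
    have "x \<bullet> x = y \<bullet> (M *v x)" using y by (simp add: inner_symmetric_matrix[OF sym])
    then show ?thesis using that by simp
  qed
  then have "\<forall>x\<in>?W. M *v x = 0 \<longrightarrow> x = 0" by blast
  \<comment> \<open>A symmetric matrix is injective on its own range, hence bounded below there by
    some \<open>e > 0\<close>.\<close>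
  from injective_imp_isometric[OF closed_subspace[OF subW] subW matrix_vector_mul_bounded_linear this]
  obtain e where e: "e > 0" "\<And>w. w \<in> ?W \<Longrightarrow> e * norm w \<le> norm (M *v w)"
    by blast
  obtain b where b: "b > 0" "\<And>x. norm (N *v x) \<le> b * norm x"
    using linear_bounded_pos[OF matrix_vector_mul_linear] by blast
  have small: "\<bar>z \<bullet> (N *v z)\<bar> \<le> t * (2 * b * b * (norm z)\<^sup>2 / e)" if t: "t > 0" "t * b \<le> e / 2" for t
  proof -
    \<comment> \<open>The span of \<open>z\<close> and the range of \<open>M\<close> has dimension
      \<open>rank M + 1\<close>, too large for the perturbed matrix to be injective on it. The
      kernel vector \<open>x\<close> found there splits as \<open>w + s *\<^sub>R z\<close>.\<close>
    have "\<not> inj_on ((*v) (M + t *\<^sub>R N)) (span (insert z ?W))"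
    proof
      assume "inj_on ((*v) (M + t *\<^sub>R N)) (span (insert z ?W))"
      then have "dim ((*v) (M + t *\<^sub>R N) ` insert z ?W) = dim (insert z ?W)"
        by (intro dim_image_eq) auto
      moreover have "dim ((*v) (M + t *\<^sub>R N) ` insert z ?W) \<le> rank (M + t *\<^sub>R N)"
        unfolding rank_dim_range by (intro dim_subset) auto
      ultimately show False using rk[OF t(1)] dimV by simp
    qed
    then obtain x where x: "x \<in> span (insert z ?W)" "x \<noteq> 0" "(M + t *\<^sub>R N) *v x = 0"
      using linear_injective_on_subspace_0[of "(*v) (M + t *\<^sub>R N)" "span (insert z ?W)"] by auto
    obtain s where "x - s *\<^sub>R z \<in> span ?W" using x(1) span_breakdown_eq by blast
    then have wW: "x - s *\<^sub>R z \<in> ?W" using subW by (simp add: span_eq_iff[THEN iffD2])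
    define w where "w = x - s *\<^sub>R z"
    have x': "x = w + s *\<^sub>R z" by (simp add: w_def)
    have Mx: "M *v x = M *v w"
      by (simp add: x' matrix_vector_right_distrib matrix_vector_mult_scaleR Mz)
    have eq: "M *v x + t *\<^sub>R (N *v x) = 0"
      using x(3) by (simp add: matrix_vector_mult_add_rdistrib scaleR_matrix_vector_assoc)
    then have "M *v w = - t *\<^sub>R (N *v x)" by (simp add: Mx add_eq_0_iff2)
    then have "norm (M *v w) = t * norm (N *v x)" using t by simp
    then have "e * norm w \<le> t * (b * norm x)"
      using e(2)[OF wW] b(2)[of x] t(1) by (metis w_def mult_le_cancel_left_pos order_trans)
    also have "norm x \<le> norm w + \<bar>s\<bar> * norm z" unfolding x' by (metis norm_scaleR norm_triangle_ineq)
    finally have "e * norm w \<le> (t * b) * norm w + t * b * \<bar>s\<bar> * norm z"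
      using t b by (simp add: algebra_simps)
    also have "(t * b) * norm w \<le> e / 2 * norm w" using t by (intro mult_right_mono) auto
    \<comment> \<open>So \<open>w\<close> is of order \<open>t\<close> relative to \<open>s\<close>.
      Pairing the kernel equation with \<open>z\<close> kills the \<open>M\<close> term, and
      \<open>z \<bullet> (N *v z)\<close> is then of order \<open>t\<close> as well.\<close>
    finally have wb: "e / 2 * norm w \<le> t * b * \<bar>s\<bar> * norm z" by (simp add: algebra_simps)
    have s0: "s \<noteq> 0"
    proof
      assume s0: "s = 0"
      then have "norm w \<le> 0" using wb e(1) by (simp add: mult_le_0_iff)
      then show False using x(2) x' s0 by simp
    qed
    have "z \<bullet> (M *v x) = 0" using zW by auto
    then have "t * (z \<bullet> (N *v x)) = 0" using eq
      by (metis add_0 inner_add_right inner_scaleR_right inner_zero_right)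
    then have "z \<bullet> (N *v w) + s * (z \<bullet> (N *v z)) = 0"
      using t by (simp add: x' matrix_vector_right_distrib matrix_vector_mult_scaleR inner_add_right)
    then have "\<bar>s\<bar> * \<bar>z \<bullet> (N *v z)\<bar> = \<bar>z \<bullet> (N *v w)\<bar>"
      by (metis abs_minus_cancel abs_mult add_eq_0_iff2)
    also have "\<dots> \<le> norm z * (b * norm w)"
      by (meson Cauchy_Schwarz_ineq2 b(2) mult_left_mono norm_ge_zero order_trans)
    also have "\<dots> = norm z * b * (2 / e) * (e / 2 * norm w)" using e by simp
    also have "\<dots> \<le> norm z * b * (2 / e) * (t * b * \<bar>s\<bar> * norm z)"
      using wb b e by (intro mult_left_mono) auto
    also have "\<dots> = \<bar>s\<bar> * (t * (2 * b * b * (norm z)\<^sup>2 / e))"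
      by (simp add: power2_eq_square)
    finally show ?thesis using s0 by (metis mult_le_cancel_left_pos zero_less_abs_iff)
  qed
  define K where "K = 2 * b * b * (norm z)\<^sup>2 / e"
  have K: "K > 0" using b e False by (simp add: K_def)
  show ?thesis
  proof (rule ccontr)
    assume nz: "z \<bullet> (N *v z) \<noteq> 0"
    \<comment> \<open>The first bound makes \<open>small\<close> applicable, the second turns its
      right-hand side into at most half of the left-hand side.\<close>
    define t where "t = min (e / (2 * b)) (\<bar>z \<bullet> (N *v z)\<bar> / (2 * K))"
    have tpos: "t > 0" using K b e nz by (simp add: t_def)
    have "t * b \<le> e / (2 * b) * b" using b by (intro mult_right_mono) (auto simp: t_def)
    also have "\<dots> = e / 2" using b by simp
    finally have "\<bar>z \<bullet> (N *v z)\<bar> \<le> t * K" using small[OF tpos] by (simp add: K_def)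
    also have "\<dots> \<le> \<bar>z \<bullet> (N *v z)\<bar> / (2 * K) * K"
      using K by (intro mult_right_mono) (auto simp: t_def)
    also have "\<dots> = \<bar>z \<bullet> (N *v z)\<bar> / 2" using K by simp
    finally show False using nz by simp
  qed
qed simp

section \<open>Laplace transform of the distance distribution\<close>

text \<open>At the multiples \<open>n * r\<close> of a small step the exponentials become powers of
  \<open>z b\<close>. Weighting these equations by the coefficients of a polynomial that vanishes at
  every frequency other than \<open>x\<close> isolates the coefficient of \<open>x\<close>.\<close>

lemma exp_sum_coeffs_unique:
  fixes a c :: "'i \<Rightarrow> real" and a' c' :: "'j \<Rightarrow> real"
  assumes fin: "finite I" "finite J" and e: "e > 0"
    and eq: "\<And>u. 0 < u \<Longrightarrow> u < e \<Longrightarrow>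
      (\<Sum>i\<in>I. c i * exp (- u * a i)) = (\<Sum>j\<in>J. c' j * exp (- u * a' j))"
  shows "(\<Sum>i | i \<in> I \<and> a i = x. c i) = (\<Sum>j | j \<in> J \<and> a' j = x. c' j)"
proof -
  define S where "S = (a ` I \<union> a' ` J) - {x}"
  have finS: "finite S" using fin by (simp add: S_def)
  \<comment> \<open>The polynomial below has degree at most \<open>card S + 1\<close>, so all the
    multiples of \<open>r\<close> in use stay below \<open>e\<close>.\<close>
  define r where "r = e / (real (card S) + 2)"
  have r: "r > 0" using e by (simp add: r_def)
  define z where "z b = exp (- r * b)" for b :: real
  have z_inj: "z b = z b' \<longleftrightarrow> b = b'" for b b' using r by (simp add: z_def)
  \<comment> \<open>The factor \<open>[:0, 1:]\<close> removes the constant term, because the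
    identity is not given at \<open>u = 0\<close>.\<close>
  define p where "p = [:0, 1:] * (\<Prod>b\<in>S. [:- z b, 1:])"
  have "degree p \<le> 1 + degree (\<Prod>b\<in>S. [:- z b, 1:])"
    unfolding p_def using degree_mult_le[of "[:0, 1:]" "\<Prod>b\<in>S. [:- z b, 1:]"] by simp
  also have "degree (\<Prod>b\<in>S. [:- z b, 1:]) \<le> card S"
    using degree_prod_sum_le[OF finS, of "\<lambda>b. [:- z b, 1:]"] by simp
  finally have deg: "degree p \<le> card S + 1" by simp
  have p0: "coeff p 0 = 0" by (simp add: p_def)
  have poly_p: "poly p y = y * (\<Prod>b\<in>S. y - z b)" for y
    by (simp add: p_def poly_prod)
  have nz: "poly p (z x) \<noteq> 0"
    using finS by (auto simp: poly_p z_inj S_def) (auto simp: z_def)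
  have zero: "poly p (z b) = 0" if "b \<in> S" for b
    using that finS by (auto simp: poly_p)
  have pick: "(\<Sum>i\<in>I'. k i * poly p (z (f i))) = (\<Sum>i | i \<in> I' \<and> f i = x. k i) * poly p (z x)"
    if "finite I'" "f ` I' \<subseteq> insert x S" for I' :: "'l set" and k f :: "'l \<Rightarrow> real"
  proof -
    have "(\<Sum>i\<in>I'. k i * poly p (z (f i))) = (\<Sum>i\<in>I'. if f i = x then k i * poly p (z x) else 0)"
      using that(2) by (intro sum.cong) (auto simp: zero)
    then show ?thesis using that(1) by (simp add: sum.If_cases sum_distrib_right Int_def)
  qed
  have expand: "(\<Sum>i\<in>I'. k i * poly p (z (f i))) = (\<Sum>n\<le>degree p. coeff p n * (\<Sum>i\<in>I'. k i * exp (- (n * r) * f i)))"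
    for I' :: "'l set" and k f :: "'l \<Rightarrow> real"
  proof -
    have "z b ^ n = exp (- (n * r) * b)" for b n
      by (simp add: z_def algebra_simps flip: exp_of_nat_mult)
    then show ?thesis
      by (simp add: poly_altdef sum_distrib_left mult_ac sum.swap[of _ _ I'])
  qed
  have "(\<Sum>n\<le>degree p. coeff p n * (\<Sum>i\<in>I. c i * exp (- (n * r) * a i)))
      = (\<Sum>n\<le>degree p. coeff p n * (\<Sum>j\<in>J. c' j * exp (- (n * r) * a' j)))"
  proof (rule sum.cong)
    fix n assume n: "n \<in> {..degree p}"
    show "coeff p n * (\<Sum>i\<in>I. c i * exp (- (n * r) * a i))
      = coeff p n * (\<Sum>j\<in>J. c' j * exp (- (n * r) * a' j))"
    proof (cases "n = 0")
      case False
      have "real n * r \<le> (real (card S) + 1) * r" using n deg r by (intro mult_right_mono) auto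
      also have "\<dots> < e" using e by (simp add: r_def field_simps)
      finally show ?thesis using eq[of "real n * r"] False r by simp
    qed (simp add: p0)
  qed simp
  then have "(\<Sum>i\<in>I. c i * poly p (z (a i))) = (\<Sum>j\<in>J. c' j * poly p (z (a' j)))"
    unfolding expand .
  moreover have "a ` I \<subseteq> insert x S" "a' ` J \<subseteq> insert x S" by (auto simp: S_def)
  ultimately show ?thesis using nz by (simp add: pick[OF fin(1)] pick[OF fin(2)])
qed

section \<open>The bilinear form and integrals of pairs of Gaussians\<close>

lemma bil_add_left: "bil B (u + v) x = bil B u x + bil B v x"
  and bil_diff_left: "bil B (u - v) x = bil B u x - bil B v x"
  and bil_add_right: "bil B x (u + v) = bil B x u + bil B x v"
  and bil_diff_right: "bil B x (u - v) = bil B x u - bil B x v"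
  and bil_scale_left: "bil B (t *\<^sub>R u) v = t * bil B u v"
  and bil_scale_right: "bil B u (t *\<^sub>R v) = t * bil B u v"
  and bil_zero_left [simp]: "bil B 0 v = 0"
  and bil_zero_right [simp]: "bil B v 0 = 0"
  by (simp_all add: bil_def inner_add_left inner_diff_left inner_add_right inner_diff_right
      matrix_vector_right_distrib matrix_vector_mult_diff_distrib matrix_vector_mult_scaleR)

lemmas bil_simps = bil_add_left bil_add_right bil_diff_left bil_diff_right
  bil_scale_left bil_scale_right

lemma bil_sym:
  assumes "transpose B = B"
  shows "bil B u v = bil B v u"
  unfolding bil_def by (metis assms dot_lmul_matrix inner_commute vector_transpose_matrix)

lemma continuous_bil: "continuous_on UNIV (\<lambda>x. bil B x x)"
  unfolding bil_def by (intro continuous_intros)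

lemma measurable_bil [measurable]:
  assumes [measurable]: "f \<in> borel_measurable M"
  shows "(\<lambda>x. bil B (f x) (f x)) \<in> borel_measurable M"
  using measurable_compose[OF assms borel_measurable_continuous_onI[OF continuous_bil]] by simp

lemma nn_integral_delta_dist:
  fixes B :: "real^'d^'d"
  assumes f: "is_prob_density f" and h [measurable]: "h \<in> borel_measurable borel"
  shows "(\<integral>\<^sup>+ t. h t \<partial>delta_dist B f) =
    (\<integral>\<^sup>+ x. \<integral>\<^sup>+ y. ennreal (f x) * (ennreal (f y) * h (bil B (x - y) (x - y))) \<partial>lborel \<partial>lborel)"
proof -
  have [measurable]: "f \<in> borel_measurable borel" using f by (simp add: is_prob_density_def)
  let ?D = "density lborel (\<lambda>x. ennreal (f x))"
  interpret prob_space ?D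
    using f by (intro prob_spaceI) (simp add: emeasure_density is_prob_density_def)
  have "(\<integral>\<^sup>+ t. h t \<partial>delta_dist B f) = (\<integral>\<^sup>+ z. h (bil B (fst z - snd z) (fst z - snd z)) \<partial>(?D \<Otimes>\<^sub>M ?D))"
    unfolding delta_dist_def by (subst nn_integral_distr) (auto simp: split_beta')
  also have "\<dots> = (\<integral>\<^sup>+ x. \<integral>\<^sup>+ y. h (bil B (x - y) (x - y)) \<partial>?D \<partial>?D)"
    by (subst nn_integral_fst[symmetric]) auto
  also have "\<dots> = (\<integral>\<^sup>+ x. ennreal (f x) * (\<integral>\<^sup>+ y. ennreal (f y) * h (bil B (x - y) (x - y)) \<partial>lborel) \<partial>lborel)"
    by (simp add: nn_integral_density)
  also have "\<dots> = (\<integral>\<^sup>+ x. \<integral>\<^sup>+ y. ennreal (f x) * (ennreal (f y) * h (bil B (x - y) (x - y))) \<partial>lborel \<partial>lborel)"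
    by (subst nn_integral_cmult[symmetric]) auto
  finally show ?thesis .
qed

lemma nn_integral_lborel_shift:
  fixes c :: "'a::euclidean_space"
  assumes [measurable]: "f \<in> borel_measurable borel"
  shows "(\<integral>\<^sup>+ x. f (x + c) \<partial>lborel) = (\<integral>\<^sup>+ x. f x \<partial>lborel)"
proof -
  have "(\<integral>\<^sup>+ x. f x \<partial>lborel) = (\<integral>\<^sup>+ x. f x \<partial>distr lborel borel ((+) c))"
    by (simp add: lborel_distr_plus)
  also have "\<dots> = (\<integral>\<^sup>+ x. f (x + c) \<partial>lborel)"
    by (subst nn_integral_distr) (auto simp: add.commute)
  finally show ?thesis by simp
qed

definition gauss :: "real^'d^'d \<Rightarrow> real^'d \<Rightarrow> real" where
  "gauss B x = exp (- (1/2) * bil B x x)"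

lemma gauss_pos: "gauss B x > 0"
  by (simp add: gauss_def)

lemma measurable_gauss [measurable]: "gauss B \<in> borel_measurable borel"
  unfolding gauss_def by measurable

text \<open>The contribution of two components centred at \<open>m\<close> and \<open>n\<close> to
  the Laplace transform at \<open>s\<close>, without weights and normalisation. With values in
  \<open>ennreal\<close> it makes sense before finiteness is known.\<close>

definition gauss_pair :: "real^'d^'d \<Rightarrow> real \<Rightarrow> real^'d \<Rightarrow> real^'d \<Rightarrow> ennreal" where
  "gauss_pair B s m n = (\<integral>\<^sup>+ x. \<integral>\<^sup>+ y.
     ennreal (gauss B (x - m) * gauss B (y - n) * exp (- s * bil B (x - y) (x - y))) \<partial>lborel \<partial>lborel)"

text \<open>Completing the square: the translation by \<open>- 2 s / (1 + 4 s)\<close> times \<open>m - n\<close>, in opposite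
  directions for the two points, removes the linear terms, so no Gaussian integral is evaluated.\<close>
lemma gauss_pair_eq:
  fixes B :: "real^'d^'d"
  assumes sym: "transpose B = B" and s: "s > 0"
  shows "gauss_pair B s m n = ennreal (exp (- (s / (1 + 4 * s)) * bil B (m - n) (m - n))) * gauss_pair B s 0 0"
proof -
  define al where "al = - 2 * s / (1 + 4 * s)"
  define be where "be = 1 / (1 + 4 * s)"
  define de where "de = m - n"
  define F where "F x y = ennreal (gauss B (x - m) * gauss B (y - n) * exp (- s * bil B (x - y) (x - y)))" for x y
  let ?G = "\<lambda>x y. ennreal (gauss B (x - 0) * gauss B (y - 0) * exp (- s * bil B (x - y) (x - y)))"
  let ?e = "exp (- (s / (1 + 4 * s)) * bil B (m - n) (m - n))"
  have q: "bil B (x + t *\<^sub>R de) (x + t *\<^sub>R de) = bil B x x + 2 * t * bil B x de + t\<^sup>2 * bil B de de" for x t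
    using bil_sym[OF sym, of x de] by (simp add: bil_simps power2_eq_square algebra_simps)
  \<comment> \<open>\<open>be\<close> is the multiple of \<open>de\<close> left in the difference of
    the translated points. The next two identities say that the linear terms cancel and give the
    exponent that remains.\<close>
  have be': "1 + 2 * al = be" using s by (simp add: al_def be_def field_simps)
  have lin0: "al + 2 * s * be = 0" using s by (simp add: al_def be_def field_simps)
  have quad0: "al\<^sup>2 + s * be\<^sup>2 = s / (1 + 4 * s)"
  proof -
    have "al\<^sup>2 + s * be\<^sup>2 = (s * (1 + 4 * s)) / ((1 + 4 * s) * (1 + 4 * s))"
      by (simp add: al_def be_def power2_eq_square add_divide_distrib[symmetric] algebra_simps)
    also have "\<dots> = s / (1 + 4 * s)" using s by simp
    finally show ?thesis .
  qed
  have pt: "F (x + (m + al *\<^sub>R de)) (y + (n - al *\<^sub>R de)) = ennreal ?e * ?G x y" for x y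
  proof -
    have "x + (m + al *\<^sub>R de) - (y + (n - al *\<^sub>R de)) = (x - y) + (1 + 2 * al) *\<^sub>R de"
      by (simp add: de_def algebra_simps scaleR_2[symmetric])
    then have 1: "x + (m + al *\<^sub>R de) - (y + (n - al *\<^sub>R de)) = (x - y) + be *\<^sub>R de"
      by (simp only: be')
    have 2: "x + (m + al *\<^sub>R de) - m = x + al *\<^sub>R de" by simp
    have 3: "y + (n - al *\<^sub>R de) - n = y + (- al) *\<^sub>R de" by simp
    have "- (1/2) * (bil B x x + 2 * al * bil B x de + al\<^sup>2 * bil B de de)
        + - (1/2) * (bil B y y + 2 * (- al) * bil B y de + (- al)\<^sup>2 * bil B de de)
        + - s * (bil B (x - y) (x - y) + 2 * be * bil B (x - y) de + be\<^sup>2 * bil B de de)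
      = - (al\<^sup>2 + s * be\<^sup>2) * bil B de de
        + (- (1/2) * bil B x x + - (1/2) * bil B y y + - s * bil B (x - y) (x - y))
        - (al + 2 * s * be) * (bil B x de - bil B y de)"
      by (simp add: bil_diff_left algebra_simps)
    also have "\<dots> = - (s / (1 + 4 * s)) * bil B de de
        + (- (1/2) * bil B x x + - (1/2) * bil B y y + - s * bil B (x - y) (x - y))"
      unfolding lin0 quad0 by simp
    finally show ?thesis
      unfolding F_def gauss_def 1 2 3 q
      by (simp only: de_def diff_zero exp_add[symmetric] ennreal_mult''[symmetric] exp_ge_zero add.assoc[symmetric] mult.assoc[symmetric])
  qed
  have [measurable]: "(\<lambda>z. F (fst z) (snd z)) \<in> borel_measurable (borel \<Otimes>\<^sub>M borel)"
    unfolding F_def by measurable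
  have [measurable]: "(\<lambda>z. F (fst z) (snd z)) \<in> borel_measurable (lborel \<Otimes>\<^sub>M lborel)"
    unfolding F_def by measurable
  have Fy: "F x \<in> borel_measurable borel" for x unfolding F_def by measurable
  have "gauss_pair B s m n = (\<integral>\<^sup>+ x. \<integral>\<^sup>+ y. F x y \<partial>lborel \<partial>lborel)"
    by (simp add: gauss_pair_def F_def)
  also have "\<dots> = (\<integral>\<^sup>+ x. \<integral>\<^sup>+ y. F x (y + (n - al *\<^sub>R de)) \<partial>lborel \<partial>lborel)"
    by (simp only: nn_integral_lborel_shift[OF Fy])
  also have "\<dots> = (\<integral>\<^sup>+ x. \<integral>\<^sup>+ y. F (x + (m + al *\<^sub>R de)) (y + (n - al *\<^sub>R de)) \<partial>lborel \<partial>lborel)"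
    by (rule nn_integral_lborel_shift[symmetric]) (unfold F_def, measurable)
  also have "\<dots> = ennreal ?e * (\<integral>\<^sup>+ x. \<integral>\<^sup>+ y. ?G x y \<partial>lborel \<partial>lborel)"
    unfolding pt by (simp add: nn_integral_cmult)
  finally show ?thesis by (simp add: gauss_pair_def)
qed

text \<open>The integrand is positive everywhere. Together with finiteness this allows the common
  factor of two Laplace transforms to be cancelled.\<close>

lemma gauss_pair_zero_pos:
  fixes B :: "real^'d^'d"
  shows "gauss_pair B s 0 0 \<noteq> 0"
proof -
  have pos: "(\<integral>\<^sup>+ x. f x \<partial>lborel) \<noteq> 0" if [measurable]: "f \<in> borel_measurable borel" and "\<And>x. f x \<noteq> 0"
    for f :: "real^'d \<Rightarrow> ennreal"
    using that(2) by (simp add: nn_integral_0_iff)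
  show ?thesis unfolding gauss_pair_def
    by (intro pos) (auto simp: ennreal_eq_0_iff mult_le_0_iff not_le[THEN iffD2, OF gauss_pos])
qed

lemma gmix_gauss:
  fixes mu :: "real^'d^'k"
  shows "gmix B w mu x = (\<Sum>i\<in>UNIV. (w $ i / sqrt ((2 * pi) ^ CARD('d))) * gauss B (x - mu $ i))"
  by (simp add: gmix_def gauss_def)

lemma gmix_ge_component:
  fixes mu :: "real^'d^'k"
  assumes "\<And>i. w $ i > 0"
  shows "(w $ i / sqrt ((2 * pi) ^ CARD('d))) * gauss B (x - mu $ i) \<le> gmix B w mu x"
  unfolding gmix_gauss
  by (rule member_le_sum) (auto intro!: mult_nonneg_nonneg divide_nonneg_nonneg less_imp_le[OF assms] less_imp_le[OF gauss_pos])

text \<open>Each component is dominated by the mixture, whose integral is 1. Both the definiteness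
  of \<open>B\<close> and the finiteness of \<open>gauss_pair\<close> are derived from this.\<close>

lemma nn_integral_gauss_finite:
  fixes mu :: "real^'d^'k"
  assumes w: "\<And>i. w $ i > 0" and f: "is_prob_density (gmix B w mu)"
  shows "(\<integral>\<^sup>+ x. ennreal (gauss B x) \<partial>lborel) < \<infinity>"
proof -
  fix i :: 'k
  define c where "c = w $ i / sqrt ((2 * pi) ^ CARD('d))"
  have c: "c > 0" using w[of i] by (simp add: c_def)
  have "ennreal c * (\<integral>\<^sup>+ x. ennreal (gauss B x) \<partial>lborel) = ennreal c * (\<integral>\<^sup>+ x. ennreal (gauss B (x - mu $ i)) \<partial>lborel)"
    using nn_integral_lborel_shift[of "\<lambda>x. ennreal (gauss B x)" "- mu $ i"] by simp
  also have "\<dots> = (\<integral>\<^sup>+ x. ennreal (c * gauss B (x - mu $ i)) \<partial>lborel)"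
    using c by (subst nn_integral_cmult[symmetric]) (simp_all add: ennreal_mult' less_imp_le)
  also have "\<dots> \<le> (\<integral>\<^sup>+ x. ennreal (gmix B w mu x) \<partial>lborel)"
    unfolding c_def by (intro nn_integral_mono ennreal_leI gmix_ge_component w)
  also have "\<dots> = 1" using f by (simp add: is_prob_density_def)
  finally have "ennreal c * (\<integral>\<^sup>+ x. ennreal (gauss B x) \<partial>lborel) \<noteq> \<top>" by (auto simp: top_unique)
  then show ?thesis using c by (auto simp: ennreal_mult_eq_top_iff less_top)
qed

text \<open>For a semidefinite form the interaction factor is at most 1, which leaves a product of
  two finite integrals as an upper bound.\<close>

lemma gauss_pair_zero_finite:
  fixes B :: "real^'d^'d"
  assumes fin: "(\<integral>\<^sup>+ x. ennreal (gauss B x) \<partial>lborel) < \<infinity>"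
    and s: "s > 0" and psd: "\<And>x. bil B x x \<ge> 0"
  shows "gauss_pair B s 0 0 \<noteq> \<top>"
proof -
  have "gauss_pair B s 0 0 \<le> (\<integral>\<^sup>+ x. \<integral>\<^sup>+ y. ennreal (gauss B x) * ennreal (gauss B y) \<partial>lborel \<partial>lborel)"
    unfolding gauss_pair_def
  proof (intro nn_integral_mono)
    fix x y :: "real^'d"
    have "gauss B x * gauss B y * exp (- s * bil B (x - y) (x - y)) \<le> gauss B x * gauss B y * 1"
      using s psd[of "x - y"] by (intro mult_left_mono) (auto intro!: mult_nonneg_nonneg less_imp_le[OF gauss_pos])
    then show "ennreal (gauss B (x - 0) * gauss B (y - 0) * exp (- s * bil B (x - y) (x - y)))
        \<le> ennreal (gauss B x) * ennreal (gauss B y)"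
      by (simp add: ennreal_mult[symmetric] less_imp_le[OF gauss_pos] ennreal_leI)
  qed
  also have "\<dots> = (\<integral>\<^sup>+ x. ennreal (gauss B x) \<partial>lborel) * (\<integral>\<^sup>+ x. ennreal (gauss B x) \<partial>lborel)"
    by (simp add: nn_integral_cmult nn_integral_multc)
  also have "\<dots> < \<top>" using fin by (simp add: ennreal_mult_less_top)
  finally show ?thesis by simp
qed

text \<open>Expand the product of the two mixtures and complete the square term by term. The factor
  behind the sum depends on \<open>B\<close> and \<open>s\<close> only, so it is shared by all
  mixtures.\<close>

lemma laplace_delta_dist:
  fixes B :: "real^'d^'d" and mu :: "real^'d^'k"
  assumes sym: "transpose B = B" and psd: "\<And>x. bil B x x \<ge> 0"
    and w: "\<And>i. w $ i > 0" and f: "is_prob_density (gmix B w mu)" and s: "s > 0"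
  shows "(\<integral>\<^sup>+ t. ennreal (exp (- s * t)) \<partial>delta_dist B (gmix B w mu)) =
    ennreal (\<Sum>(i, j)\<in>UNIV. w $ i * w $ j * exp (- (s / (1 + 4 * s)) * bil B (mu $ i - mu $ j) (mu $ i - mu $ j)))
      * (ennreal (1 / (2 * pi) ^ CARD('d)) * gauss_pair B s 0 0)"
proof -
  let ?r = "sqrt ((2 * pi) ^ CARD('d))"
  have r: "?r > 0" by simp
  have rr: "1 / ?r * (1 / ?r) = 1 / (2 * pi) ^ CARD('d)"
    by (simp add: real_sqrt_mult_self)
  let ?E = "\<lambda>x y. exp (- s * bil B (x - y) (x - y))"
  let ?k = "\<lambda>i j. w $ i * w $ j * (1 / (2 * pi) ^ CARD('d))"
  have k: "0 \<le> ?k i j" for i j using w by (simp add: less_imp_le)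
  have g0: "0 \<le> gauss B x" for x by (rule less_imp_le[OF gauss_pos])
  have m0: "0 \<le> gmix B w mu x" for x using f by (simp add: is_prob_density_def)
  have "(\<integral>\<^sup>+ t. ennreal (exp (- s * t)) \<partial>delta_dist B (gmix B w mu))
    = (\<integral>\<^sup>+ x. \<integral>\<^sup>+ y. ennreal (gmix B w mu x) * (ennreal (gmix B w mu y) * ennreal (?E x y)) \<partial>lborel \<partial>lborel)"
    by (rule nn_integral_delta_dist[OF f]) measurable
  also have "\<dots> = (\<integral>\<^sup>+ x. \<integral>\<^sup>+ y. (\<Sum>(i, j)\<in>UNIV. ennreal (?k i j) *
      ennreal (gauss B (x - mu $ i) * gauss B (y - mu $ j) * ?E x y)) \<partial>lborel \<partial>lborel)"
  proof (intro nn_integral_cong)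
    fix x y
    have nonneg: "0 \<le> ?k i j * (gauss B (x - mu $ i) * gauss B (y - mu $ j) * ?E x y)" for i j
      by (rule mult_nonneg_nonneg[OF k]) (intro mult_nonneg_nonneg g0 exp_ge_zero)
    have "ennreal (gmix B w mu x) * (ennreal (gmix B w mu y) * ennreal (?E x y))
      = ennreal (gmix B w mu x * gmix B w mu y * ?E x y)"
      by (simp add: ennreal_mult m0 mult.assoc)
    also have "gmix B w mu x * gmix B w mu y * ?E x y
      = (\<Sum>(i, j)\<in>UNIV. ?k i j * (gauss B (x - mu $ i) * gauss B (y - mu $ j) * ?E x y))"
      unfolding gmix_gauss sum_product
      unfolding sum_distrib_right UNIV_Times_UNIV[symmetric] sum.cartesian_product[symmetric]
      unfolding rr[symmetric] by (intro sum.cong refl) (simp only: divide_inverse mult_1 mult_ac)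
    also have "ennreal \<dots> = (\<Sum>(i, j)\<in>UNIV. ennreal (?k i j) *
      ennreal (gauss B (x - mu $ i) * gauss B (y - mu $ j) * ?E x y))"
      unfolding split_beta' by (subst sum_ennreal[symmetric]) (simp_all only: nonneg ennreal_mult'[OF k])
    finally show "ennreal (gmix B w mu x) * (ennreal (gmix B w mu y) * ennreal (?E x y)) = \<dots>" .
  qed
  also have "\<dots> = (\<Sum>(i, j)\<in>UNIV. ennreal (?k i j) * gauss_pair B s (mu $ i) (mu $ j))"
    unfolding split_beta' gauss_pair_def
    by (simp add: nn_integral_sum nn_integral_cmult)
  also have "\<dots> = (\<Sum>(i, j)\<in>UNIV. ennreal (w $ i * w $ j * exp (- (s / (1 + 4 * s)) * bil B (mu $ i - mu $ j) (mu $ i - mu $ j)))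
      * (ennreal (1 / (2 * pi) ^ CARD('d)) * gauss_pair B s 0 0))"
  proof (intro sum.cong refl, clarify)
    fix i j
    let ?e = "exp (- (s / (1 + 4 * s)) * bil B (mu $ i - mu $ j) (mu $ i - mu $ j))"
    have "ennreal (?k i j) * (ennreal ?e * gauss_pair B s 0 0) = ennreal (?k i j * ?e) * gauss_pair B s 0 0"
      unfolding ennreal_mult'[OF k] by (rule mult.assoc[symmetric])
    also have "?k i j * ?e = (w $ i * w $ j * ?e) * (1 / (2 * pi) ^ CARD('d))" by simp
    also have "ennreal \<dots> * gauss_pair B s 0 0 = ennreal (w $ i * w $ j * ?e) * (ennreal (1 / (2 * pi) ^ CARD('d)) * gauss_pair B s 0 0)"
      using w by (subst ennreal_mult) (auto simp: less_imp_le mult.assoc)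
    finally show "ennreal (?k i j) * gauss_pair B s (mu $ i) (mu $ j) =
       ennreal (w $ i * w $ j * ?e) * (ennreal (1 / (2 * pi) ^ CARD('d)) * gauss_pair B s 0 0)"
      unfolding gauss_pair_eq[OF sym s, of "mu $ i" "mu $ j"] .
  qed
  also have "\<dots> = ennreal (\<Sum>(i, j)\<in>UNIV. w $ i * w $ j * exp (- (s / (1 + 4 * s)) * bil B (mu $ i - mu $ j) (mu $ i - mu $ j)))
      * (ennreal (1 / (2 * pi) ^ CARD('d)) * gauss_pair B s 0 0)"
    using w unfolding split_beta' sum_distrib_right[symmetric]
    by (subst sum_ennreal) (auto simp: less_imp_le)
  finally show ?thesis .
qed

lemma delta_dist_determines_weights:
  fixes B :: "real^'d^'d" and mu mu' :: "real^'d^'k"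
  assumes sym: "transpose B = B" and psd: "\<And>x. bil B x x \<ge> 0"
    and w: "\<And>i. w $ i > 0" and f: "is_prob_density (gmix B w mu)"
    and w': "\<And>i. w' $ i > 0" and f': "is_prob_density (gmix B w' mu')"
    and eq: "delta_dist B (gmix B w' mu') = delta_dist B (gmix B w mu)"
  shows "(\<Sum>(i, j) | bil B (mu $ i - mu $ j) (mu $ i - mu $ j) = x. w $ i * w $ j)
    = (\<Sum>(i, j) | bil B (mu' $ i - mu' $ j) (mu' $ i - mu' $ j) = x. w' $ i * w' $ j)"
proof -
  have cancel: "a = b" if "a * K = b * K" "K \<noteq> 0" "K \<noteq> \<top>" for a b K :: ennreal
    using that by (simp add: mult.commute[of _ K] ennreal_mult_cancel_left)
  have "(\<Sum>(i, j)\<in>UNIV. w $ i * w $ j * exp (- u * bil B (mu $ i - mu $ j) (mu $ i - mu $ j)))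
    = (\<Sum>(i, j)\<in>UNIV. w' $ i * w' $ j * exp (- u * bil B (mu' $ i - mu' $ j) (mu' $ i - mu' $ j)))"
    (is "?l = ?r") if u: "0 < u" "u < 1/4" for u
  proof -
    \<comment> \<open>This inverts \<open>s / (1 + 4 * s) = u\<close>. Positive \<open>s\<close>
      correspond exactly to \<open>u\<close> between 0 and 1/4, whence the bounds on
      \<open>u\<close>.\<close>
    define s where "s = u / (1 - 4 * u)"
    have s: "s > 0" using u by (simp add: s_def)
    have su: "s / (1 + 4 * s) = u" using u by (simp add: s_def field_simps)
    let ?K = "ennreal (1 / (2 * pi) ^ CARD('d)) * gauss_pair B s 0 0"
    have K: "?K \<noteq> 0" "?K \<noteq> \<top>"
      using gauss_pair_zero_pos[of B s] gauss_pair_zero_finite[OF nn_integral_gauss_finite[OF w f] s psd]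
      by (auto simp: ennreal_mult_eq_top_iff)
    have "ennreal ?l * ?K = ennreal ?r * ?K"
      using laplace_delta_dist[OF sym psd w f s] laplace_delta_dist[OF sym psd w' f' s]
      unfolding su eq by simp
    then have "ennreal ?l = ennreal ?r" by (rule cancel[OF _ K])
    moreover have "0 \<le> ?l" "0 \<le> ?r"
      using w w' by (auto intro!: sum_nonneg mult_nonneg_nonneg simp: less_imp_le)
    ultimately show ?thesis by (simp only: ennreal_inj)
  qed
  then have "(\<Sum>p | p \<in> UNIV \<and> (case p of (i, j) \<Rightarrow> bil B (mu $ i - mu $ j) (mu $ i - mu $ j)) = x. case p of (i, j) \<Rightarrow> w $ i * w $ j)
    = (\<Sum>p | p \<in> UNIV \<and> (case p of (i, j) \<Rightarrow> bil B (mu' $ i - mu' $ j) (mu' $ i - mu' $ j)) = x. case p of (i, j) \<Rightarrow> w' $ i * w' $ j)"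
    by (intro exp_sum_coeffs_unique[where e = "1/4"]) (auto simp: split_beta')
  then show ?thesis by (simp add: split_beta')
qed

section \<open>Squared distances as quadratic forms\<close>

text \<open>Otherwise the form is negative on a ball around some \<open>v\<close>, and by
  homogeneity on its dilates by every \<open>n \<ge> 1\<close>. There \<open>gauss B\<close> is at
  least 1, and the volumes of the dilates grow without bound, contradicting integrability.\<close>

lemma positive_definite_of_density:
  fixes B :: "real^'d^'d" and mu :: "real^'d^'k"
  assumes sym: "transpose B = B" and nondeg: "nondegenerate B"
    and w: "\<And>i. w $ i > 0" and f: "is_prob_density (gmix B w mu)"
    and x: "x \<noteq> 0"
  shows "bil B x x > 0"
proof (rule ccontr)
  assume "\<not> bil B x x > 0"
  then have le: "bil B x x \<le> 0" by simp
  obtain v where v: "bil B v v < 0"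
  proof (cases "bil B x x = 0")
    case True
    obtain u where u: "bil B x u \<noteq> 0" using nondeg x unfolding nondegenerate_def by blast
    \<comment> \<open>Along the isotropic direction \<open>x\<close> the form is affine in
      \<open>t\<close>; this \<open>t\<close> gives it the value -1.\<close>
    define t where "t = - (bil B u u + 1) / (2 * bil B x u)"
    have "bil B (u + t *\<^sub>R x) (u + t *\<^sub>R x) = bil B u u + 2 * t * bil B x u"
      using bil_sym[OF sym, of u x] True by (simp add: bil_simps)
    also have "\<dots> = - 1" using u by (simp add: t_def field_simps)
    finally show ?thesis using that[of "u + t *\<^sub>R x"] by simp
  next
    case False
    then show ?thesis using le that[of x] by simp
  qed
  have "open {y. bil B y y < 0}"
    using continuous_bil by (intro open_Collect_less) auto
  then obtain e where e: "e > 0" "ball v e \<subseteq> {y. bil B y y < 0}"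
    using v unfolding open_contains_ball by blast
  obtain r where r: "(\<integral>\<^sup>+ x. ennreal (gauss B x) \<partial>lborel) = ennreal r" "r \<ge> 0"
    using nn_integral_gauss_finite[OF w f] by (auto simp: less_top_ennreal)
  define c where "c = unit_ball_vol (real CARD('d)) * e ^ CARD('d)"
  have c: "c > 0" using e by (simp add: c_def)
  have bound: "c * real n \<le> r" if n: "n \<ge> 1" for n :: nat
  proof -
    let ?b = "ball (real n *\<^sub>R v) (real n * e)"
    have "indicator ?b y \<le> ennreal (gauss B y)" for y
    proof (cases "y \<in> ?b")
      case True
      have "real n * dist v ((1 / real n) *\<^sub>R y) = norm (real n *\<^sub>R (v - (1 / real n) *\<^sub>R y))"
        by (simp add: dist_norm)
      also have "\<dots> = dist (real n *\<^sub>R v) y" using n by (simp add: dist_norm scaleR_diff_right)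
      also have "\<dots> < real n * e" using True by simp
      finally have "(1 / real n) *\<^sub>R y \<in> ball v e" using n by simp
      then have "bil B ((1 / real n) *\<^sub>R y) ((1 / real n) *\<^sub>R y) < 0" using e by blast
      then have "bil B y y < 0" using n by (simp add: bil_simps divide_less_0_iff)
      then have "1 \<le> gauss B y" by (simp add: gauss_def)
      then show ?thesis using True by simp
    qed simp
    then have "(\<integral>\<^sup>+ y. indicator ?b y \<partial>lborel) \<le> (\<integral>\<^sup>+ x. ennreal (gauss B x) \<partial>lborel)"
      by (intro nn_integral_mono)
    then have "emeasure lborel ?b \<le> (\<integral>\<^sup>+ x. ennreal (gauss B x) \<partial>lborel)" by simp
    moreover have "emeasure lborel ?b = ennreal (c * real n ^ CARD('d))"
      using e by (subst emeasure_ball) (auto simp: c_def power_mult_distrib mult_ac)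
    ultimately have "c * real n ^ CARD('d) \<le> r" using r by simp
    moreover have "real n ^ 1 \<le> real n ^ CARD('d)" using n by (intro power_increasing) (auto simp: Suc_leI)
    ultimately show ?thesis using c by (smt (verit) mult_left_mono power_one_right)
  qed
  obtain n :: nat where "r / c < real n" using reals_Archimedean2 by blast
  moreover have "r / c \<ge> 0" using r c by simp
  ultimately have "c * real n > r" "n \<ge> 1" using c r by (cases n; auto simp: field_simps)+
  then show False using bound by fastforce
qed

section \<open>Projection onto zero-sum vectors and the quadratic form of a function on
  pairs\<close>

definition centering :: "real^'n^'n" where
  "centering = (\<chi> i j. (if i = j then 1 else 0) - 1 / real CARD('n))"

lemma transpose_centering [simp]: "transpose centering = centering"
  by (vector centering_def transpose_def)

lemma centering_mult: "centering *v x = x - ((\<Sum>i\<in>UNIV. x $ i) / real CARD('n)) *\<^sub>R 1"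
  for x :: "real^'n"
  by (simp add: vec_eq_iff centering_def matrix_vector_mult_def left_diff_distrib sum_subtractf
      sum_divide_distrib if_distrib[of "\<lambda>c. c * _"] cong: if_cong)

lemma centering_one: "centering *v (1 :: real^'n) = 0"
  by (simp add: centering_mult)

lemma centering_eq_self: "(\<Sum>i\<in>UNIV. x $ i) = 0 \<Longrightarrow> centering *v x = x"
  by (simp add: centering_mult)

lemma sum_centering: "(\<Sum>i\<in>UNIV. (centering *v x) $ i) = 0"
  for x :: "real^'n"
  by (simp add: centering_mult sum_subtractf)

definition edges :: "'k set set" where
  "edges = {e. card e = 2}"

lemma edges_iff: "e \<in> edges \<longleftrightarrow> (\<exists>i j. i \<noteq> j \<and> e = {i, j})"
  by (auto simp: edges_def card_2_iff)

lemma insert_in_edges [simp]: "{i, j} \<in> edges \<longleftrightarrow> i \<noteq> j"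
  by (auto simp: edges_def card_insert_if)

definition edge_matrix :: "('k::finite set \<Rightarrow> real) \<Rightarrow> real^'k^'k" where
  "edge_matrix g = (\<chi> i j. if i = j then 0 else g {i, j})"

text \<open>The form of \<open>edge_matrix g\<close> restricted to zero-sum vectors, extended by
  zero along the constant vector, so that its rank is an ordinary matrix rank.\<close>

definition centered :: "('k::finite set \<Rightarrow> real) \<Rightarrow> real^'k^'k" where
  "centered g = centering ** edge_matrix g ** centering"

lemma transpose_edge_matrix: "transpose (edge_matrix g) = edge_matrix g"
  by (vector edge_matrix_def transpose_def) (auto simp: insert_commute)

lemma transpose_centered: "transpose (centered g) = centered g"
  by (simp add: centered_def matrix_transpose_mul transpose_edge_matrix matrix_mul_assoc)

lemma centered_cong: "(\<And>e. e \<in> edges \<Longrightarrow> g e = h e) \<Longrightarrow> centered g = centered h"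
  by (simp add: centered_def edge_matrix_def cong: if_cong)

lemma centered_vector: "centered g *v x = centering *v (edge_matrix g *v (centering *v x))"
  by (simp add: centered_def matrix_vector_mul_assoc matrix_mul_assoc)

lemma centered_add: "centered (\<lambda>e. g e + t * h e) = centered g + t *\<^sub>R centered h"
proof -
  have "edge_matrix (\<lambda>e. g e + t * h e) = edge_matrix g + t *\<^sub>R edge_matrix h"
    by (auto simp: edge_matrix_def vec_eq_iff)
  then show ?thesis
    by (simp add: matrix_eq centered_vector matrix_vector_mult_add_rdistrib scaleR_matrix_vector_assoc[symmetric]
        matrix_vector_right_distrib matrix_vector_mult_scaleR)
qed

lemma inner_centered:
  assumes "(\<Sum>i\<in>UNIV. x $ i) = 0" "(\<Sum>i\<in>UNIV. y $ i) = 0"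
  shows "x \<bullet> (centered g *v y) = x \<bullet> (edge_matrix g *v y)"
  using assms by (simp add: centered_vector centering_eq_self inner_symmetric_matrix[OF transpose_centering])

lemma inner_edge_matrix:
  "x \<bullet> (edge_matrix g *v y) = (\<Sum>i\<in>UNIV. \<Sum>j\<in>UNIV. edge_matrix g $ i $ j * (x $ i * y $ j))"
  by (simp add: inner_vec_def matrix_vector_mult_def sum_distrib_left mult_ac)

text \<open>Summing over both orders and halving gives a function of the unordered pair without
  choosing an order; the diagonal terms vanish.\<close>

definition sqd :: "real^'d^'d \<Rightarrow> real^'d^'k \<Rightarrow> 'k::finite set \<Rightarrow> real" where
  "sqd B mu e = (\<Sum>i\<in>e. \<Sum>j\<in>e. bil B (mu $ i - mu $ j) (mu $ i - mu $ j)) / 2"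

lemma bil_minus_swap: "bil B (u - v) (u - v) = bil B (v - u) (v - u)"
  by (simp add: bil_simps)

lemma sqd_edge:
  assumes "i \<noteq> j"
  shows "sqd B mu {i, j} = bil B (mu $ i - mu $ j) (mu $ i - mu $ j)"
  using assms bil_minus_swap[of B "mu $ i" "mu $ j"] by (simp add: sqd_def)

text \<open>Centring removes the terms that depend on one index only. What remains is -2 times the
  centred Gram matrix, which factors through \<open>mu\<close> and hence through a space of
  dimension \<open>CARD('d)\<close>.\<close>

lemma rank_centered_sqd:
  fixes B :: "real^'d^'d" and mu :: "real^'d^'k"
  assumes sym: "transpose B = B"
  shows "rank (centered (sqd B mu)) \<le> CARD('d)"
proof -
  define G where "G = mu ** B ** transpose mu"
  have G: "G $ i $ j = bil B (mu $ i) (mu $ j)" for i j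
  proof -
    have "axis i 1 \<bullet> (G *v axis j 1) = (transpose mu *v axis i 1) \<bullet> (B *v (transpose mu *v axis j 1))"
      unfolding G_def by (metis dot_lmul_matrix matrix_vector_mul_assoc transpose_matrix_vector)
    moreover have "transpose mu *v axis i 1 = mu $ i" for i
      by (simp add: matrix_vector_mult_basis column_def transpose_def vec_eq_iff)
    ultimately show ?thesis
      by (simp add: bil_def matrix_vector_mult_basis column_def inner_axis')
  qed
  define a where "a = (\<chi> i. bil B (mu $ i) (mu $ i))"
  have E: "edge_matrix (sqd B mu) $ i $ j = a $ i + a $ j - 2 * G $ i $ j" for i j
    using bil_sym[OF sym, of "mu $ i" "mu $ j"]
    by (auto simp: edge_matrix_def sqd_edge G a_def bil_simps)
  define c :: real where "c = - 2"
  have "centered (sqd B mu) *v x = c *\<^sub>R (centering *v (G *v (centering *v x)))" for x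
  proof -
    define y where "y = centering *v x"
    have y: "(\<Sum>i\<in>UNIV. y $ i) = 0" by (simp add: y_def sum_centering)
    have "edge_matrix (sqd B mu) *v y = (\<Sum>j\<in>UNIV. a $ j * y $ j) *\<^sub>R 1 - 2 *\<^sub>R (G *v y)"
      using y by (simp add: vec_eq_iff matrix_vector_mult_def E ring_distribs sum.distrib sum_subtractf
          sum_distrib_left[symmetric] mult.assoc)
    then show ?thesis
      by (simp add: c_def centered_vector y_def matrix_vector_mult_diff_distrib matrix_vector_mult_scaleR centering_one)
  qed
  then have "centered (sqd B mu) = (c *\<^sub>R centering) ** mu ** (B ** transpose mu ** centering)"
    by (simp add: matrix_eq G_def matrix_vector_mul_assoc[symmetric] scaleR_matrix_vector_assoc[symmetric] matrix_mul_assoc[symmetric])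
  then have "rank (centered (sqd B mu)) \<le> rank ((c *\<^sub>R centering) ** mu)"
    by (simp add: rank_mul_le_left)
  also have "\<dots> \<le> rank mu" by (rule rank_mul_le_right)
  also have "\<dots> \<le> CARD('d)" using rank_bound[of mu] by simp
  finally show ?thesis .
qed

section \<open>Cut functions and the descent of the rank bound\<close>

definition cut_fn :: "'k set \<Rightarrow> 'k set \<Rightarrow> real" where
  "cut_fn S e = (if card (e \<inter> S) = 1 then 1 else 0)"

lemma cut_fn_edge:
  assumes "i \<noteq> j"
  shows "cut_fn S {i, j} = (if i \<in> S \<longleftrightarrow> j \<in> S then 0 else 1)"
  using assms by (auto simp: cut_fn_def Int_insert_left)

text \<open>A pair with exactly one point in \<open>{p, q}\<close> is counted once positively and
  once negatively, and only \<open>{p, q}\<close> survives. Hence cuts span all functions on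
  pairs.\<close>

lemma edge_indicator_cuts:
  assumes "e \<in> edges" "p \<noteq> q"
  shows "cut_fn {p} e + cut_fn {q} e - cut_fn {p, q} e = (if e = {p, q} then 2 else 0)"
proof -
  obtain i j where "e = {i, j}" "i \<noteq> j" using assms(1) by (auto simp: edges_iff)
  then show ?thesis using assms(2)
    by (cases "i = p"; cases "i = q"; cases "j = p"; cases "j = q") (auto simp: cut_fn_edge doubleton_eq_iff)
qed

text \<open>The dimension is that of the linear span of the points. Since squared distances are
  invariant under translation, all configurations of affine dimension at most \<open>s\<close> are
  covered.\<close>

definition rank_bounded_on :: "real^'d^'d \<Rightarrow> ('k::finite set \<Rightarrow> 'k set) \<Rightarrow> nat \<Rightarrow> bool" where
  "rank_bounded_on B sg s \<longleftrightarrow> (\<forall>mu :: real^'d^'k. dim (range (($) mu)) \<le> s \<longrightarrow>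
     rank (centered (sqd B mu \<circ> sg)) \<le> s)"

text \<open>At a configuration where the rank is attained, every cut direction is tangent to the rank
  variety. Cuts span all edge functions, so the form would vanish at a kernel vector of zero sum
  in every direction, which is absurd.\<close>
lemma rank_bounded_descend:
  fixes B :: "real^'d^'d" and sg :: "'k::finite set \<Rightarrow> 'k set"
  assumes sym: "transpose B = B" and pd: "\<And>x. x \<noteq> 0 \<Longrightarrow> bil B x x > 0"
    and bij: "bij_betw sg edges edges" and k: "CARD('d) + 2 \<le> CARD('k)" and s: "s < CARD('d)"
    and R: "rank_bounded_on B sg (Suc s)"
  shows "rank_bounded_on B sg s"
  unfolding rank_bounded_on_def
proof (intro allI impI)
  fix mu :: "real^'d^'k"
  assume dim: "dim (range (($) mu)) \<le> s"
  define M where "M = centered (sqd B mu \<circ> sg)"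
  have sgE: "sg e \<in> edges" if "e \<in> edges" for e using bij that by (auto simp: bij_betw_def)
  have "rank M \<le> Suc s" using R dim unfolding rank_bounded_on_def M_def by auto
  moreover have "rank M \<noteq> Suc s"
  proof
    assume rM: "rank M = Suc s"
    have "dim ((*v) B ` range (($) mu)) \<le> dim (range (($) mu))" by (intro dim_image_le) simp
    \<comment> \<open>The points do not fill the space, so there is a direction \<open>n\<close>
      that is \<open>B\<close>-orthogonal to all of them.\<close>
    then have "dim ((*v) B ` range (($) mu)) < DIM(real^'d)" using dim s by simp
    then obtain n where n: "n \<noteq> 0" "\<And>y. y \<in> span ((*v) B ` range (($) mu)) \<Longrightarrow> orthogonal n y"
      using orthogonal_to_subspace_exists by blast
    have nmu: "bil B n (mu $ i) = 0" "bil B (mu $ i) n = 0" for i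
      using n(2)[of "B *v mu $ i"] bil_sym[OF sym, of n "mu $ i"]
      by (auto simp: bil_def orthogonal_def intro: span_base)
    have qn: "bil B n n > 0" using pd n by blast
    have sM: "transpose M = M" by (simp add: M_def transpose_centered)
    \<comment> \<open>The kernel has dimension \<open>CARD('k) - Suc s\<close>, which is at least 2
      because \<open>Suc s \<le> CARD('d)\<close>. So it contains more than the constant
      vectors.\<close>
    have "\<not> {y. M *v y = 0} \<subseteq> span {1}"
    proof
      assume "{y. M *v y = 0} \<subseteq> span {1}"
      then have "dim {y. M *v y = 0} \<le> dim {1 :: real^'k}" by (metis dim_span dim_subset)
      also have "\<dots> \<le> 1" by simp
      finally show False using dim_kernel_symmetric_matrix[OF sM] rM s k by simp
    qed
    then obtain y where y: "M *v y = 0" "y \<notin> span {1}" by blast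
    define z where "z = centering *v y"
    have sz: "(\<Sum>i\<in>UNIV. z $ i) = 0" by (simp add: z_def sum_centering)
    have Mz: "M *v z = 0"
      using y(1) centering_eq_self[OF sz] unfolding M_def centered_vector by (simp add: z_def)
    have z0: "z \<noteq> 0"
    proof
      assume "z = 0"
      then have "y = ((\<Sum>i\<in>UNIV. y $ i) / real CARD('k)) *\<^sub>R 1" by (simp add: z_def centering_mult)
      then show False using y(2) by (metis span_base span_scale insertI1)
    qed
    have cut0: "z \<bullet> (centered (cut_fn S \<circ> sg) *v z) = 0" for S
    proof (rule rank_perturbation[OF sM Mz])
      fix t :: real assume t: "t > 0"
      \<comment> \<open>Moving the points of \<open>S\<close> along \<open>n\<close> by a vector of
        squared length \<open>t\<close> adds \<open>t\<close> to exactly the squared distances cut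
        by \<open>S\<close>, and raises the dimension of the span by at most one.\<close>
      define nu where "nu = (\<chi> i. mu $ i + (if i \<in> S then sqrt (t / bil B n n) else 0) *\<^sub>R n)"
      have "sqd B nu e = sqd B mu e + t * cut_fn S e" if eE: "e \<in> edges" for e
      proof -
        obtain i j where e: "e = {i, j}" "i \<noteq> j" using eE by (auto simp: edges_iff)
        define c where "c = (if i \<in> S then sqrt (t / bil B n n) else 0) - (if j \<in> S then sqrt (t / bil B n n) else 0)"
        have d: "nu $ i - nu $ j = (mu $ i - mu $ j) + c *\<^sub>R n"
          by (simp add: nu_def c_def algebra_simps)
        have "c * c * bil B n n = t * cut_fn S e"
          using t qn e by (auto simp: c_def cut_fn_edge)
        moreover have "bil B ((mu $ i - mu $ j) + c *\<^sub>R n) ((mu $ i - mu $ j) + c *\<^sub>R n)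
            = bil B (mu $ i - mu $ j) (mu $ i - mu $ j) + c * c * bil B n n"
          by (simp add: bil_simps nmu)
        ultimately show ?thesis using e by (simp add: sqd_edge d)
      qed
      then have "centered (sqd B nu \<circ> sg) = centered (\<lambda>e. (sqd B mu \<circ> sg) e + t * (cut_fn S \<circ> sg) e)"
        by (intro centered_cong) (auto simp: sgE)
      then have eq: "centered (sqd B nu \<circ> sg) = M + t *\<^sub>R centered (cut_fn S \<circ> sg)"
        by (simp only: centered_add M_def)
      have "range (($) nu) \<subseteq> span (insert n (range (($) mu)))"
        by (auto simp: nu_def intro!: span_add span_scale intro: span_base)
      then have "dim (range (($) nu)) \<le> dim (insert n (range (($) mu)))"
        by (metis dim_span dim_subset)
      also have "\<dots> \<le> Suc s" using dim by (simp add: dim_insert)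
      finally show "rank (M + t *\<^sub>R centered (cut_fn S \<circ> sg)) \<le> rank M"
        using R unfolding rank_bounded_on_def eq[symmetric] rM by blast
    qed
    \<comment> \<open>Combining three cuts gives the indicator of the single pair
      \<open>sg {p, q}\<close>. Pulled back along \<open>sg\<close> it is the indicator of
      \<open>{p, q}\<close>, whose form at \<open>z\<close> is a multiple of this product.\<close>
    have zz: "z $ p * z $ q = 0" if pq: "p \<noteq> q" for p q
    proof -
      define F where "F S i j = (if i = j then 0 else cut_fn S (sg {i, j})) * (z $ i * z $ j)" for S i j
      have F0: "(\<Sum>i\<in>UNIV. \<Sum>j\<in>UNIV. F S i j) = 0" for S
      proof -
        have "(\<Sum>i\<in>UNIV. \<Sum>j\<in>UNIV. edge_matrix (cut_fn S \<circ> sg) $ i $ j * (z $ i * z $ j)) = 0"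
          using cut0[of S] by (simp only: inner_centered[OF sz sz] inner_edge_matrix)
        moreover have "edge_matrix (cut_fn S \<circ> sg) $ i $ j * (z $ i * z $ j) = F S i j" for i j
          by (simp add: edge_matrix_def F_def)
        ultimately show ?thesis by simp
      qed
      obtain a b where ab: "sg {p, q} = {a, b}" "a \<noteq> b"
        using sgE[of "{p, q}"] pq by (auto simp: edges_iff)
      have inj: "sg {i, j} = {a, b} \<longleftrightarrow> {i, j} = {p, q}" if "i \<noteq> j" for i j
        using bij_betw_imp_inj_on[OF bij] that pq ab by (metis inj_on_eq_iff insert_in_edges)
      have "F {a} i j + F {b} i j - F {a, b} i j = (if (i, j) \<in> {(p, q), (q, p)} then 2 * (z $ p * z $ q) else 0)" for i j
      proof (cases "i = j")
        case False
        have "F {a} i j + F {b} i j - F {a, b} i j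
          = (cut_fn {a} (sg {i, j}) + cut_fn {b} (sg {i, j}) - cut_fn {a, b} (sg {i, j})) * (z $ i * z $ j)"
          using False by (simp add: F_def algebra_simps)
        also have "\<dots> = (if {i, j} = {p, q} then 2 else 0) * (z $ i * z $ j)"
          using False edge_indicator_cuts[OF sgE ab(2), of "{i, j}"] inj[OF False] by simp
        also have "\<dots> = (if (i, j) \<in> {(p, q), (q, p)} then 2 * (z $ p * z $ q) else 0)"
          by (auto simp: doubleton_eq_iff)
        finally show ?thesis .
      qed (use pq in \<open>auto simp: F_def\<close>)
      then have "(\<Sum>i\<in>UNIV. \<Sum>j\<in>UNIV. if (i, j) \<in> {(p, q), (q, p)} then 2 * (z $ p * z $ q) else 0)
        = (\<Sum>i\<in>UNIV. \<Sum>j\<in>UNIV. F {a} i j + F {b} i j - F {a, b} i j)" by simp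
      also have "\<dots> = 0" by (simp add: sum.distrib sum_subtractf F0)
      finally have "(\<Sum>x\<in>UNIV. if x \<in> {(p, q), (q, p)} then 2 * (z $ p * z $ q) else 0) = 0"
        unfolding sum.cartesian_product by (simp add: split_beta' prod_eq_iff)
      then show ?thesis using pq by (simp add: sum.If_cases) blast
    qed
    \<comment> \<open>As \<open>z\<close> has zero sum, its square at \<open>p\<close> is minus the
      sum of its products with the other entries.\<close>
    have "z $ p = 0" for p
    proof -
      have "z $ p * z $ p = z $ p * (z $ p - (\<Sum>i\<in>UNIV. z $ i))" by (simp add: sz)
      also have "(\<Sum>i\<in>UNIV. z $ i) = z $ p + (\<Sum>i\<in>UNIV - {p}. z $ i)"
        by (simp add: sum.remove)
      also have "z $ p * (z $ p - (z $ p + (\<Sum>i\<in>UNIV - {p}. z $ i))) = - (\<Sum>i\<in>UNIV - {p}. z $ p * z $ i)"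
        by (simp add: sum_distrib_left)
      also have "\<dots> = 0" by (auto intro!: sum.neutral zz)
      finally show ?thesis by simp
    qed
    then show False using z0 by (simp add: vec_eq_iff)
  qed
  ultimately show "rank (centered (sqd B mu \<circ> sg)) \<le> s" unfolding M_def by linarith
qed

section \<open>Permutations of pairs preserving realizability\<close>

text \<open>The range lies on a line, so the two-by-two minors of the form vanish.\<close>

lemma rank_one_inner:
  fixes M :: "real^'n^'n"
  assumes sym: "transpose M = M" and r: "rank M \<le> 1"
  shows "(x \<bullet> (M *v x)) * (y \<bullet> (M *v y)) = (x \<bullet> (M *v y))\<^sup>2"
proof -
  obtain C where C: "C \<subseteq> range ((*v) M)" "independent C" "range ((*v) M) \<subseteq> span C" "card C = dim (range ((*v) M))"
    by (rule basis_exists)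
  have "card C = rank M" by (simp only: C(4) rank_dim_range)
  then have "card C \<le> Suc 0" using r by simp
  moreover have "finite C" using C(2) by (rule independent_imp_finite)
  ultimately have "\<forall>a\<in>C. \<forall>b\<in>C. a = b" by (metis card_le_Suc0_iff_eq)
  then have "\<exists>u. C \<subseteq> {u}" by blast
  then obtain u where "C \<subseteq> {u}" by blast
  then have sp: "range ((*v) M) \<subseteq> span {u}" using C(3) span_mono by blast
  have "M *v v \<in> span {u}" for v using sp by (rule subsetD) simp
  then have "\<exists>a. M *v v = a *\<^sub>R u" for v by (auto simp: span_singleton)
  then obtain a b where ab: "M *v x = a *\<^sub>R u" "M *v y = b *\<^sub>R u" by blast
  have "x \<bullet> (M *v y) = y \<bullet> (M *v x)"
    by (metis inner_commute inner_symmetric_matrix[OF sym])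
  then have e: "b * (x \<bullet> u) = a * (y \<bullet> u)" by (simp add: ab)
  have "(x \<bullet> (M *v x)) * (y \<bullet> (M *v y)) = (b * (x \<bullet> u)) * (a * (y \<bullet> u))" by (simp add: ab)
  also have "\<dots> = (x \<bullet> (M *v y))\<^sup>2" by (simp add: e[symmetric] ab power2_eq_square)
  finally show ?thesis .
qed

text \<open>The minor for two edge vectors of a triangle at \<open>l\<close>; this is the relation
  between the squared distances of three collinear points.\<close>

lemma rank_one_triangle:
  fixes g :: "'k::finite set \<Rightarrow> real"
  assumes r: "rank (centered g) \<le> 1" and d: "i \<noteq> j" "i \<noteq> l" "j \<noteq> l"
  shows "4 * g {i, l} * g {j, l} = (g {i, j} - g {i, l} - g {j, l})\<^sup>2"
proof -
  define x :: "real^'k" where "x = axis i 1 - axis l 1"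
  define y :: "real^'k" where "y = axis j 1 - axis l 1"
  have s: "(\<Sum>i\<in>UNIV. x $ i) = 0" "(\<Sum>i\<in>UNIV. y $ i) = 0"
    by (simp_all add: x_def y_def sum_subtractf axis_def)
  have ax: "axis a 1 \<bullet> (edge_matrix g *v axis b 1) = (if a = b then 0 else g {a, b})" for a b
    by (simp add: edge_matrix_def[of g] matrix_vector_mult_basis column_def inner_axis')
  have "x \<bullet> (edge_matrix g *v x) = - 2 * g {i, l}" "y \<bullet> (edge_matrix g *v y) = - 2 * g {j, l}"
    "x \<bullet> (edge_matrix g *v y) = g {i, j} - g {i, l} - g {j, l}"
    using d by (simp_all add: x_def y_def matrix_vector_mult_diff_distrib inner_diff_left inner_diff_right ax
        insert_commute)
  then show ?thesis
    using rank_one_inner[OF transpose_centered r, of x y] by (simp add: inner_centered s)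
qed

lemma card_star: "card {e \<in> edges. v \<in> e} = CARD('k) - 1"
  for v :: "'k::finite"
proof -
  have "{e \<in> edges. v \<in> e} = (\<lambda>j. {v, j}) ` (UNIV - {v})"
    by (auto simp: edges_iff)
  moreover have "inj_on (\<lambda>j. {v, j}) (UNIV - {v})"
    by (auto simp: inj_on_def doubleton_eq_iff)
  ultimately show ?thesis by (simp add: card_image)
qed

text \<open>The triangle condition makes \<open>F\<close> the set of pairs cut by some
  \<open>S\<close>. The product of the sizes of \<open>S\<close> and its complement is then one less
  than their sum, which forces one of them to be a singleton.\<close>

lemma cut_of_star_size:
  fixes F :: "'k::finite set set"
  assumes F: "F \<subseteq> edges"
    and tri: "\<And>i j l. i \<noteq> j \<Longrightarrow> i \<noteq> l \<Longrightarrow> j \<noteq> l \<Longrightarrow> {i, j} \<in> F \<longleftrightarrow> (({i, l} \<in> F) \<noteq> ({j, l} \<in> F))"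
    and card: "card F = CARD('k) - 1"
  shows "\<exists>p. \<forall>e\<in>edges. e \<in> F \<longleftrightarrow> p \<in> e"
proof -
  fix o' :: 'k
  \<comment> \<open>The side of the cut that contains the arbitrary base point
    \<open>o'\<close>.\<close>
  define S where "S = {i. i = o' \<or> {i, o'} \<notin> F}"
  have cutF: "{i, j} \<in> F \<longleftrightarrow> ((i \<in> S) \<noteq> (j \<in> S))" if "i \<noteq> j" for i j
    using tri[OF that, of o'] that by (cases "i = o'"; cases "j = o'") (auto simp: S_def insert_commute)
  have "F = (\<lambda>(i, j). {i, j}) ` (S \<times> - S)"
  proof (intro equalityI subsetI)
    fix e assume e: "e \<in> F"
    then obtain i j where ij: "e = {i, j}" "i \<noteq> j" using edges_iff[THEN iffD1, OF subsetD[OF F e]] by blast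
    then have "(i \<in> S) \<noteq> (j \<in> S)" using cutF[OF ij(2)] e by simp
    then show "e \<in> (\<lambda>(i, j). {i, j}) ` (S \<times> - S)" using ij
      by (cases "i \<in> S") (auto simp: image_iff insert_commute)
  next
    fix e assume "e \<in> (\<lambda>(i, j). {i, j}) ` (S \<times> - S)"
    then obtain i j where "e = {i, j}" "i \<in> S" "j \<notin> S" by auto
    then show "e \<in> F" using cutF[of i j] by auto
  qed
  moreover have "inj_on (\<lambda>(i, j). {i, j}) (S \<times> - S)"
    by (auto simp: inj_on_def doubleton_eq_iff)
  ultimately have "card F = card S * card (- S)" by (simp add: card_image card_cartesian_product)
  moreover have sum: "card S + card (- S) = CARD('k)"
    by (metis card_Un_disjoint Compl_disjoint Compl_partition finite)
  moreover have "card S \<ge> 1" by (simp add: Suc_le_eq card_gt_0_iff) (auto simp: S_def)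
  ultimately have "card S * card (- S) + 1 = card S + card (- S)" using card by simp
  then have "(int (card S) - 1) * (int (card (- S)) - 1) = 0"
    by (simp add: algebra_simps flip: of_nat_mult of_nat_add)
  then have "card S = 1 \<or> card (- S) = 1" by auto
  then have "\<exists>p. S = {p} \<or> - S = {p}" by (auto simp: card_1_singleton_iff)
  then obtain p where "S = {p} \<or> - S = {p}" by blast
  then have p: "(\<forall>x. x \<in> S \<longleftrightarrow> x = p) \<or> (\<forall>x. x \<in> S \<longleftrightarrow> x \<noteq> p)" by blast
  have "e \<in> F \<longleftrightarrow> p \<in> e" if e: "e \<in> edges" for e
  proof -
    obtain i j where ij: "e = {i, j}" "i \<noteq> j" using e by (auto simp: edges_iff)
    have "(i \<in> S) \<noteq> (j \<in> S) \<longleftrightarrow> (i = p) \<noteq> (j = p)" using p by metis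
    then show ?thesis using cutF[OF ij(2)] ij by auto
  qed
  then show ?thesis by blast
qed

text \<open>Descending to rank one shows that the preimage under \<open>sg\<close> of every star is
  a star. The centres of these preimages define \<open>p\<close>, which is why \<open>sg\<close>
  takes the pair of images back to \<open>{i, j}\<close>.\<close>

lemma vertex_permutation_of_edge_permutation:
  fixes B :: "real^'d^'d" and sg :: "'k::finite set \<Rightarrow> 'k set"
  assumes sym: "transpose B = B" and pd: "\<And>x. x \<noteq> 0 \<Longrightarrow> bil B x x > 0"
    and bij: "bij_betw sg edges edges" and k: "CARD('d) + 2 \<le> CARD('k)"
    and R: "rank_bounded_on B sg CARD('d)"
  shows "\<exists>p. inj p \<and> (\<forall>i j. i \<noteq> j \<longrightarrow> sg {p i, p j} = {i, j})"
proof -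
  have "rank_bounded_on B sg s" if "1 \<le> s" "s \<le> CARD('d)" for s
    using that(2)
  proof (induction s rule: inc_induct)
    case (step n)
    then show ?case using rank_bounded_descend[OF sym pd bij k] by blast
  qed (rule R)
  then have R1: "rank_bounded_on B sg 1" by (simp add: Suc_leI)
  have sgE: "sg e \<in> edges" if "e \<in> edges" for e using bij that by (auto simp: bij_betw_def)
  have inj: "e = e'" if "sg e = sg e'" "e \<in> edges" "e' \<in> edges" for e e'
    using bij_betw_imp_inj_on[OF bij] that by (auto simp: inj_on_def)
  have "\<exists>p. \<forall>e\<in>edges. v \<in> sg e \<longleftrightarrow> p \<in> e" for v
  proof -
    define n :: "real^'d" where "n = 1"
    have "n \<noteq> 0" by (simp add: n_def)
    define c where "c = bil B n n"
    have c: "c > 0" using pd[OF \<open>n \<noteq> 0\<close>] by (simp add: c_def)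
    \<comment> \<open>Only \<open>v\<close> is moved off the origin: the points lie on a line, and
      the squared distance is nonzero exactly on the star of \<open>v\<close>.\<close>
    define mu :: "real^'d^'k" where "mu = (\<chi> i. if i = v then n else 0)"
    define g where "g = sqd B mu \<circ> sg"
    have "range (($) mu) \<subseteq> span {n}" by (auto simp: mu_def span_zero intro: span_base)
    then have "dim (range (($) mu)) \<le> dim {n}" by (metis dim_span dim_subset)
    also have "\<dots> \<le> 1" by simp
    finally have r: "rank (centered g) \<le> 1" using R1 unfolding rank_bounded_on_def g_def by blast
    have sq: "sqd B mu e = (if v \<in> e then c else 0)" if e: "e \<in> edges" for e
    proof -
      obtain i j where "e = {i, j}" "i \<noteq> j" using e by (auto simp: edges_iff)
      then show ?thesis using bil_minus_swap[of B 0 n] by (auto simp: sqd_edge mu_def c_def)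
    qed
    define F where "F = {e \<in> edges. v \<in> sg e}"
    have g: "g {i, j} = (if {i, j} \<in> F then c else 0)" if "i \<noteq> j" for i j
      using that by (simp add: g_def sq sgE F_def)
    have "bij_betw sg F {e \<in> edges. v \<in> e}"
      unfolding F_def using bij
      by (intro bij_betw_subset[OF bij, of F "{e \<in> edges. v \<in> e}", unfolded F_def]) (auto simp: bij_betw_def image_iff)
    then have "card F = CARD('k) - 1" by (simp add: bij_betw_same_card card_star)
    \<comment> \<open>For values 0 and \<open>c\<close> the collinearity relation leaves only
      triangles with none or two of their sides in \<open>F\<close>.\<close>
    moreover have "{i, j} \<in> F \<longleftrightarrow> (({i, l} \<in> F) \<noteq> ({j, l} \<in> F))" if d: "i \<noteq> j" "i \<noteq> l" "j \<noteq> l" for i j l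
      using rank_one_triangle[OF r d] c unfolding g[OF d(1)] g[OF d(2)] g[OF d(3)]
      by (cases "{i, j} \<in> F"; cases "{i, l} \<in> F"; cases "{j, l} \<in> F") (auto simp: power2_eq_square)
    moreover have "F \<subseteq> edges" by (auto simp: F_def)
    ultimately obtain p where "\<forall>e\<in>edges. e \<in> F \<longleftrightarrow> p \<in> e" using cut_of_star_size by metis
    then show ?thesis by (auto simp: F_def)
  qed
  then obtain p where p: "\<And>v e. e \<in> edges \<Longrightarrow> v \<in> sg e \<longleftrightarrow> p v \<in> e" by metis
  have two: "sg e = {i, j}" if h: "e \<in> edges" "i \<noteq> j" "i \<in> sg e" "j \<in> sg e" for e i j
  proof -
    obtain a b where "sg e = {a, b}" using sgE[OF h(1)] by (auto simp: edges_iff)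
    then show ?thesis using h by auto
  qed
  \<comment> \<open>If \<open>i\<close> and \<open>j\<close> had the same centre, \<open>sg\<close>
    would send every pair through it to \<open>{i, j}\<close>; with at least three points there are
    two such pairs.\<close>
  have pinj: "inj p"
  proof (rule injI, rule ccontr)
    fix i j assume eq: "p i = p j" and ij: "i \<noteq> j"
    have "CARD('k) \<ge> 3" using k zero_less_card_finite[where 'a = 'd] by linarith
    then have "card (UNIV - {p i}) \<ge> 2" by simp
    then obtain T where T: "T \<subseteq> UNIV - {p i}" "card T = 2"
      using obtain_subset_with_card_n by metis
    obtain a b where "T = {a, b}" "a \<noteq> b" using T(2) by (auto simp: card_2_iff)
    with T(1) have ab: "a \<noteq> p i" "b \<noteq> p i" "a \<noteq> b" by auto
    have "sg {p i, c} = {i, j}" if "c \<noteq> p i" for c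
      using that ij p[of "{p i, c}"] eq by (intro two) simp_all
    then have "sg {p i, a} = sg {p i, b}" using ab by simp
    then have "{p i, a} = {p i, b}" by (rule inj) (simp_all add: ab ab[symmetric])
    then show False using ab by (auto simp: doubleton_eq_iff)
  qed
  have "sg {p i, p j} = {i, j}" if "i \<noteq> j" for i j
  proof -
    have "p i \<noteq> p j" using pinj that by (auto simp: inj_def)
    then show ?thesis using that p[of "{p i, p j}"] by (intro two) auto
  qed
  then show ?thesis using pinj by blast
qed

section \<open>Generic configurations\<close>

lemma poly_fns_cmult: "p \<in> poly_fns \<Longrightarrow> (\<lambda>m. c * p m) \<in> poly_fns"
  by (rule poly_fns.mult[OF poly_fns.const])

lemma poly_fns_diff:
  assumes "p \<in> poly_fns" "q \<in> poly_fns"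
  shows "(\<lambda>m. p m - q m) \<in> poly_fns"
  using poly_fns.add[OF assms(1) poly_fns_cmult[OF assms(2), of "- 1"]] by simp

lemma poly_fns_sum:
  assumes "\<And>i. i \<in> I \<Longrightarrow> p i \<in> poly_fns"
  shows "(\<lambda>m. \<Sum>i\<in>I. p i m) \<in> poly_fns"
  using assms by (induction I rule: infinite_finite_induct) (auto intro: poly_fns.intros)

lemma poly_fns_prod:
  assumes "\<And>i. i \<in> I \<Longrightarrow> p i \<in> poly_fns"
  shows "(\<lambda>m. \<Prod>i\<in>I. p i m) \<in> poly_fns"
  using assms by (induction I rule: infinite_finite_induct) (auto intro: poly_fns.intros)

lemma poly_fns_det:
  fixes A :: "real^'d^'k \<Rightarrow> real^'n^'n"
  assumes "\<And>i j. (\<lambda>m. A m $ i $ j) \<in> poly_fns"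
  shows "(\<lambda>m. det (A m)) \<in> poly_fns"
  unfolding det_def by (intro poly_fns_sum poly_fns_cmult poly_fns_prod assms)

text \<open>Reduces the nonvanishing of polynomials in many variables to univariate
  polynomials.\<close>

lemma poly_fns_on_line:
  assumes "p \<in> poly_fns"
  shows "\<exists>r :: real poly. \<forall>t. p (a + t *\<^sub>R (b - a)) = poly r t"
  using assms
proof induction
  case (const c)
  show ?case by (rule exI[of _ "[:c:]"]) simp
next
  case (coord i j)
  show ?case by (rule exI[of _ "[:a $ i $ j, (b - a) $ i $ j:]"]) simp
next
  case (add p q)
  then obtain r s where "\<forall>t. p (a + t *\<^sub>R (b - a)) = poly r t" "\<forall>t. q (a + t *\<^sub>R (b - a)) = poly s t"
    by blast
  then show ?case by (intro exI[of _ "r + s"]) simp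
next
  case (mult p q)
  then obtain r s where "\<forall>t. p (a + t *\<^sub>R (b - a)) = poly r t" "\<forall>t. q (a + t *\<^sub>R (b - a)) = poly s t"
    by blast
  then show ?case by (intro exI[of _ "r * s"]) simp
qed

text \<open>A single witnessing polynomial replaces the closed set, so that conjunctions correspond
  to products.\<close>

definition generic :: "(real^'d^'k \<Rightarrow> bool) \<Rightarrow> bool" where
  "generic Q \<longleftrightarrow> (\<exists>p\<in>poly_fns. (\<exists>m. p m \<noteq> 0) \<and> (\<forall>m. p m \<noteq> 0 \<longrightarrow> Q m))"

text \<open>On the line through a nonzero of each polynomial both restrictions are nonzero, hence so
  is their product.\<close>

lemma generic_conj:
  assumes "generic Q" "generic Q'"
  shows "generic (\<lambda>m. Q m \<and> Q' m)"
proof -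
  obtain p a where p: "p \<in> poly_fns" "p a \<noteq> 0" "\<And>m. p m \<noteq> 0 \<Longrightarrow> Q m"
    using assms(1) unfolding generic_def by blast
  obtain q b where q: "q \<in> poly_fns" "q b \<noteq> 0" "\<And>m. q m \<noteq> 0 \<Longrightarrow> Q' m"
    using assms(2) unfolding generic_def by blast
  obtain r s where r: "\<And>t. p (a + t *\<^sub>R (b - a)) = poly r t" and s: "\<And>t. q (a + t *\<^sub>R (b - a)) = poly s t"
    using poly_fns_on_line[OF p(1), of a b] poly_fns_on_line[OF q(1), of a b] by blast
  have "poly r 0 \<noteq> 0" "poly s 1 \<noteq> 0" using r[of 0] s[of 1] p(2) q(2) by auto
  then have "r * s \<noteq> 0" by auto
  then obtain t where "poly (r * s) t \<noteq> 0" by (metis poly_all_0_iff_0)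
  then have "p (a + t *\<^sub>R (b - a)) * q (a + t *\<^sub>R (b - a)) \<noteq> 0" by (simp add: r s)
  then show ?thesis unfolding generic_def
    using poly_fns.mult[OF p(1) q(1)] p(3) q(3) by (intro bexI[of _ "\<lambda>m. p m * q m"]) auto
qed

lemma generic_ball:
  assumes "finite I" "\<And>i. i \<in> I \<Longrightarrow> generic (Q i)"
  shows "generic (\<lambda>m. \<forall>i\<in>I. Q i m)"
  using assms
proof (induction I)
  case empty
  show ?case unfolding generic_def by (intro bexI[of _ "\<lambda>_. 1"]) (auto intro: poly_fns.const)
next
  case (insert i I)
  then show ?case using generic_conj[of "Q i" "\<lambda>m. \<forall>i\<in>I. Q i m"] by simp
qed

lemma generic_zariski:
  assumes "generic Q"
  shows "\<exists>Z. zariski_closed Z \<and> Z \<noteq> UNIV \<and> (\<forall>m. m \<notin> Z \<longrightarrow> Q m)"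
proof -
  obtain p a where p: "p \<in> poly_fns" "p a \<noteq> 0" "\<And>m. p m \<noteq> 0 \<Longrightarrow> Q m"
    using assms unfolding generic_def by blast
  have "zariski_closed {m. \<forall>q\<in>{p}. q m = 0}" unfolding zariski_closed_def using p(1) by blast
  then show ?thesis using p by (intro exI[of _ "{m. \<forall>q\<in>{p}. q m = 0}"]) auto
qed

lemma poly_fns_sqd: "(\<lambda>m. sqd B m e) \<in> poly_fns"
proof -
  have "(\<lambda>m. bil B (m $ i - m $ j) (m $ i - m $ j)) \<in> poly_fns" for i j
    unfolding bil_def inner_vec_def matrix_vector_mult_def
    by (simp, intro poly_fns_sum poly_fns_cmult poly_fns_diff poly_fns.mult poly_fns.coord)
  then have "(\<lambda>m. (1/2) * (\<Sum>i\<in>e. \<Sum>j\<in>e. bil B (m $ i - m $ j) (m $ i - m $ j))) \<in> poly_fns"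
    by (intro poly_fns_cmult poly_fns_sum)
  then show ?thesis by (simp add: sqd_def)
qed

text \<open>One configuration violating the bound yields \<open>C\<close> with a nonzero determinant
  there. This determinant is a polynomial in the means, and wherever it does not vanish the rank
  exceeds \<open>CARD('d)\<close>.\<close>

lemma generic_rank:
  fixes B :: "real^'d^'d" and sg :: "'k::finite set \<Rightarrow> 'k set"
  assumes "\<not> rank_bounded_on B sg CARD('d)"
  shows "generic (\<lambda>mu :: real^'d^'k. CARD('d) < rank (centered (sqd B mu \<circ> sg)))"
proof -
  obtain nu :: "real^'d^'k" where "CARD('d) < rank (centered (sqd B nu \<circ> sg))"
    using assms unfolding rank_bounded_on_def by (auto simp: not_le)
  then obtain C where C: "det (centered (sqd B nu \<circ> sg) + C) \<noteq> 0"
      "\<And>N. rank N \<le> CARD('d) \<Longrightarrow> det (N + C) = 0"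
    using det_detects_rank[OF transpose_centered] by blast
  have entry: "(\<lambda>mu. edge_matrix (sqd B mu \<circ> sg) $ i $ j) \<in> poly_fns" for i j
    by (cases "i = j") (simp_all add: edge_matrix_def poly_fns.const poly_fns_sqd)
  have "(\<lambda>mu. det (centered (sqd B mu \<circ> sg) + C)) \<in> poly_fns"
    unfolding centered_def
    by (rule poly_fns_det)
      (simp add: matrix_matrix_mult_def, intro poly_fns_sum poly_fns.add poly_fns.mult poly_fns.const entry)
  then show ?thesis unfolding generic_def
    using C by (intro bexI[of _ "\<lambda>mu. det (centered (sqd B mu \<circ> sg) + C)"]) (auto simp: not_le[symmetric])
qed

lemma sqd_single:
  fixes n :: "real^'d"
  assumes "e \<in> edges"
  shows "sqd B (\<chi> i. if i = v then n else 0) e = (if v \<in> e then bil B n n else 0)"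
proof -
  obtain i j where "e = {i, j}" "i \<noteq> j" using assms by (auto simp: edges_iff)
  then show ?thesis using bil_minus_swap[of B 0 n] by (auto simp: sqd_edge)
qed

lemma generic_sqd_distinct:
  fixes B :: "real^'d^'d"
  assumes pd: "\<And>x. x \<noteq> 0 \<Longrightarrow> bil B x x > 0" and e: "e \<in> edges" "e' \<in> edges" "e \<noteq> e'"
  shows "generic (\<lambda>mu :: real^'d^'k. sqd B mu e \<noteq> sqd B mu e')"
proof -
  have "\<not> e \<subseteq> e'" using e unfolding edges_def
    by (metis card_subset_eq finite mem_Collect_eq)
  \<comment> \<open>Displacing only a point that belongs to one pair and not to the other separates
    the two squared distances.\<close>
  then obtain v where "v \<in> e" "v \<notin> e'" by blast
  then have "sqd B ((\<chi> i. if i = v then 1 else 0) :: real^'d^'k) e - sqd B (\<chi> i. if i = v then 1 else 0) e' \<noteq> 0"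
    using e pd[of 1] by (simp add: sqd_single)
  then show ?thesis unfolding generic_def
    by (intro bexI[of _ "\<lambda>mu. sqd B mu e - sqd B mu e'"] poly_fns_diff poly_fns_sqd) auto
qed

lemma generic_sqd_nonzero:
  fixes B :: "real^'d^'d"
  assumes pd: "\<And>x. x \<noteq> 0 \<Longrightarrow> bil B x x > 0" and e: "e \<in> edges"
  shows "generic (\<lambda>mu :: real^'d^'k. sqd B mu e \<noteq> 0)"
proof -
  obtain v where "v \<in> e" using e by (auto simp: edges_iff)
  then have "sqd B ((\<chi> i. if i = v then 1 else 0) :: real^'d^'k) e \<noteq> 0"
    using e pd[of 1] by (simp add: sqd_single)
  then show ?thesis unfolding generic_def by (intro bexI[of _ "\<lambda>mu. sqd B mu e"] poly_fns_sqd) auto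
qed

text \<open>The polynomial is the determinant of the differences to \<open>c\<close> at
  \<open>CARD('d)\<close> other indices. It equals 1 when these means are the basis vectors and the
  mean at \<open>c\<close> is 0.\<close>

lemma generic_spanning:
  assumes "CARD('d) < CARD('k)"
  shows "generic (\<lambda>mu :: real^'d^'k. span (range (\<lambda>i. mu $ i - mu $ c)) = UNIV)"
proof -
  have "card (UNIV :: 'd set) \<le> card (UNIV - {c})" using assms by simp
  then obtain f :: "'d \<Rightarrow> 'k" where f: "range f \<subseteq> UNIV - {c}" "inj f"
    using card_le_inj[of "UNIV :: 'd set" "UNIV - {c}"] by auto
  define p where "p mu = det (\<chi> j. mu $ f j - mu $ c)" for mu :: "real^'d^'k"
  have "p \<in> poly_fns"
    unfolding p_def by (rule poly_fns_det) (simp, intro poly_fns_diff poly_fns.coord)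
  moreover have "p (\<chi> i. if i \<in> range f then axis (inv f i) 1 else 0) \<noteq> 0"
  proof -
    have "(\<chi> j. axis j 1) = (mat 1 :: real^'d^'d)" by (simp add: vec_eq_iff axis_def mat_def)
    moreover have "c \<notin> range f" using f(1) by blast
    ultimately show ?thesis using f(2) by (simp add: p_def inv_f_f del: image_iff)
  qed
  moreover have "span (range (\<lambda>i. mu $ i - mu $ c)) = UNIV" if "p mu \<noteq> 0" for mu
  proof -
    let ?A = "\<chi> j. mu $ f j - mu $ c"
    have "rank ?A = CARD('d)" using that rank_bound[of ?A] by (simp add: p_def det_eq_0_rank)
    then have "span (rows ?A) = UNIV" by (simp add: row_rank_def flip: dim_eq_full)
    moreover have "row j ?A = mu $ f j - mu $ c" for j by (simp add: row_def vec_eq_iff)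
    then have "rows ?A \<subseteq> range (\<lambda>i. mu $ i - mu $ c)" by (auto simp: rows_def)
    ultimately show ?thesis using span_mono by blast
  qed
  ultimately show ?thesis unfolding generic_def by blast
qed

section \<open>Recovering the isometry and the weights\<close>

lemma isometry_from_gram:
  fixes B :: "real^'d^'d" and a a' :: "'k::finite \<Rightarrow> real^'d"
  assumes pd: "\<And>x. x \<noteq> 0 \<Longrightarrow> bil B x x > 0" and sp: "span (range a) = UNIV"
    and gram: "\<And>i j. bil B (a' i) (a' j) = bil B (a i) (a j)"
  shows "\<exists>A. (\<forall>u v. bil B (A *v u) (A *v v) = bil B u v) \<and> (\<forall>i. A *v a i = a' i)"
proof -
  define T where "T b x = (\<Sum>i\<in>UNIV. (x $ i) *\<^sub>R b i)" for b :: "'k \<Rightarrow> real^'d" and x :: "real^'k"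
  have lin: "linear (T b)" for b
    unfolding T_def by (intro linearI) (auto simp: scaleR_add_left sum.distrib scaleR_sum_right)
  have axis: "T b (axis i 1) = b i" for b i
    by (simp add: T_def axis_def if_distrib[of "\<lambda>c. c *\<^sub>R _"] cong: if_cong)
  have suml: "bil B (\<Sum>i\<in>S. f i) v = (\<Sum>i\<in>S. bil B (f i) v)" and sumr: "bil B v (\<Sum>i\<in>S. f i) = (\<Sum>i\<in>S. bil B v (f i))"
    for S :: "'k set" and f v
    by (induction S rule: infinite_finite_induct) (simp_all add: bil_simps)
  have iso: "bil B (T a' x) (T a' y) = bil B (T a x) (T a y)" for x y
    by (simp add: T_def suml sumr bil_simps gram)
  have "range a \<subseteq> range (T a)" by (metis axis image_subset_iff rangeI)
  then have "span (range a) \<subseteq> range (T a)"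
    by (intro span_minimal linear_subspace_image[OF lin]) auto
  then have "surj (T a)" using sp by auto
  then obtain g where g: "linear g" "T a \<circ> g = id"
    using linear_surjective_right_inverse[OF lin] by blast
  then have Tg: "T a (g u) = u" for u by (metis comp_apply id_apply)
  \<comment> \<open>Take coefficients with respect to \<open>a\<close> and recombine them with
    \<open>a'\<close>.\<close>
  define A where "A = matrix (T a' \<circ> g)"
  have A: "A *v u = T a' (g u)" for u
    using matrix_works[of "T a' \<circ> g"] linear_compose[OF g(1) lin] by (simp add: A_def linear_matrix_vector_mul_eq)
  have "bil B (A *v u) (A *v v) = bil B u v" for u v by (simp add: A iso Tg)
  moreover have "A *v a i = a' i" for i
  proof -
    \<comment> \<open>The chosen coefficients of \<open>a i\<close> may differ from the obvious ones
      by a relation among the \<open>a\<close>. Equal Gram matrices and definiteness make it a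
      relation among the \<open>a'\<close> too.\<close>
    let ?x = "g (a i) - axis i 1"
    have "T a ?x = 0" by (simp add: linear_diff[OF lin] Tg axis)
    then have "bil B (T a' ?x) (T a' ?x) = 0" by (simp add: iso)
    then have "T a' ?x = 0" using pd by fastforce
    then show ?thesis by (simp add: A linear_diff[OF lin] axis)
  qed
  ultimately show ?thesis by blast
qed

text \<open>The sum is over ordered pairs, so the only matching pair counts twice; the nonzero
  distance excludes the diagonal.\<close>

lemma weight_sum_edge:
  fixes mu :: "real^'d^'k" and w :: "real^'k"
  assumes inj: "inj_on (sqd B mu) edges" and nz: "\<And>e. e \<in> edges \<Longrightarrow> sqd B mu e \<noteq> 0" and ij: "i \<noteq> j"
  shows "(\<Sum>(a, b) | bil B (mu $ a - mu $ b) (mu $ a - mu $ b) = sqd B mu {i, j}. w $ a * w $ b) = 2 * (w $ i * w $ j)"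
proof -
  have "bil B (mu $ a - mu $ b) (mu $ a - mu $ b) = sqd B mu {i, j} \<longleftrightarrow> (a, b) \<in> {(i, j), (j, i)}" for a b
  proof (cases "a = b")
    case True
    then show ?thesis using nz[of "{i, j}"] ij by auto
  next
    case False
    then have "bil B (mu $ a - mu $ b) (mu $ a - mu $ b) = sqd B mu {i, j} \<longleftrightarrow> {a, b} = {i, j}"
      using inj_on_eq_iff[OF inj, of "{a, b}" "{i, j}"] ij by (simp add: sqd_edge)
    then show ?thesis by (auto simp: doubleton_eq_iff)
  qed
  then have "{(a, b). bil B (mu $ a - mu $ b) (mu $ a - mu $ b) = sqd B mu {i, j}} = {(i, j), (j, i)}"
    by (simp only: Collect_mem_eq case_prod_eta split_def prod.collapse)
  then show ?thesis using ij by simp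
qed

text \<open>With three distinct indices, the square of \<open>w i\<close> is the product of two pair
  products divided by the third.\<close>

lemma weights_eq_of_products:
  fixes w w' :: "'k::finite \<Rightarrow> real"
  assumes k: "CARD('k) \<ge> 3" and pos: "\<And>i. w i > 0" "\<And>i. w' i > 0"
    and eq: "\<And>i j. i \<noteq> j \<Longrightarrow> w i * w j = w' i * w' j"
  shows "w i = w' i"
proof -
  have "card (UNIV - {i}) \<ge> 2" using k by simp
  then obtain T where T: "T \<subseteq> UNIV - {i}" "card T = 2"
    using obtain_subset_with_card_n by metis
  obtain j l where "T = {j, l}" "j \<noteq> l" using T(2) by (auto simp: card_2_iff)
  with T(1) have d: "j \<noteq> i" "l \<noteq> i" "j \<noteq> l" by auto
  have "(w i)\<^sup>2 * (w j * w l) = (w i * w j) * (w i * w l)" by (simp add: power2_eq_square)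
  also have "\<dots> = (w' i)\<^sup>2 * (w' j * w' l)" using d by (simp add: eq power2_eq_square)
  also have "w' j * w' l = w j * w l" using d by (simp add: eq)
  finally have "(w i)\<^sup>2 = (w' i)\<^sup>2" using pos(1)[of j] pos(1)[of l] by simp
  then show ?thesis using pos by (meson less_imp_le power2_eq_imp_eq)
qed

section \<open>Reconstruction\<close>

lemma same_delta_dist_isometric:
  fixes B :: "real^'d^'d" and mu mu' :: "real^'d^'k::finite" and w w' :: "real^'k"
  assumes sym: "transpose B = B" and pd: "\<And>x. x \<noteq> 0 \<Longrightarrow> bil B x x > 0"
    and k: "CARD('d) + 2 \<le> CARD('k)"
    and gen_inj: "inj_on (sqd B mu) edges" and gen_nz: "\<And>e. e \<in> edges \<Longrightarrow> sqd B mu e \<noteq> 0"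
    and gen_span: "span (range (\<lambda>i. mu $ i - mu $ c)) = UNIV"
    and gen_rank: "\<And>sg. bij_betw sg edges edges \<Longrightarrow> rank (centered (sqd B mu \<circ> sg)) \<le> CARD('d) \<Longrightarrow>
      rank_bounded_on B sg CARD('d)"
    and w: "\<And>i. w $ i > 0" and f: "is_prob_density (gmix B w mu)"
    and w': "\<And>i. w' $ i > 0" and f': "is_prob_density (gmix B w' mu')"
    and eq: "delta_dist B (gmix B w' mu') = delta_dist B (gmix B w mu)"
  shows "\<exists>(A :: real^'d^'d) b. (\<forall>u v. bil B (A *v u) (A *v v) = bil B u v) \<and>
    (\<forall>x. gmix B w mu x = gmix B w' mu' (A *v x + b))"
proof -
  have psd: "bil B x x \<ge> 0" for x using pd[of x] by (cases "x = 0") (auto simp: less_imp_le)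
  note W = delta_dist_determines_weights[OF sym psd w f w' f' eq]
  \<comment> \<open>The total weight at each distance of \<open>mu\<close> is positive, so the
    distance must also occur for \<open>mu'\<close>.\<close>
  have ex: "\<exists>e'\<in>edges. sqd B mu' e' = sqd B mu e" if e: "e \<in> edges" for e
  proof -
    obtain i j where ij: "e = {i, j}" "i \<noteq> j" using e by (auto simp: edges_iff)
    have "(\<Sum>(a, b) | bil B (mu' $ a - mu' $ b) (mu' $ a - mu' $ b) = sqd B mu {i, j}. w' $ a * w' $ b) = 2 * (w $ i * w $ j)"
      using W[of "sqd B mu {i, j}"] weight_sum_edge[OF gen_inj gen_nz ij(2), of w] by simp
    moreover have "2 * (w $ i * w $ j) \<noteq> 0" using w[of i] w[of j] by simp
    ultimately have "{(a, b). bil B (mu' $ a - mu' $ b) (mu' $ a - mu' $ b) = sqd B mu {i, j}} \<noteq> {}"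
      by (metis (no_types, lifting) sum.empty)
    then obtain a b where ab: "bil B (mu' $ a - mu' $ b) (mu' $ a - mu' $ b) = sqd B mu {i, j}"
      by blast
    then have "a \<noteq> b" using gen_nz[OF e] ij by auto
    then show ?thesis using ab ij by (intro bexI[of _ "{a, b}"]) (simp_all add: sqd_edge)
  qed
  then obtain ta where ta: "\<And>e. e \<in> edges \<Longrightarrow> ta e \<in> edges" "\<And>e. e \<in> edges \<Longrightarrow> sqd B mu' (ta e) = sqd B mu e"
    by metis
  have "inj_on ta edges"
    using ta(2) gen_inj by (metis inj_on_def)
  then have bij: "bij_betw ta edges edges"
    using ta(1) by (simp add: bij_betw_def endo_inj_surj image_subset_iff)
  \<comment> \<open>\<open>ta\<close> is an injective self-map of the finite set of pairs, hence
    invertible. Its inverse expresses the distances of \<open>mu'\<close> as permuted distances of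
    \<open>mu\<close>, and these satisfy the rank bound.\<close>
  define sg where "sg = inv_into edges ta"
  have bij': "bij_betw sg edges edges" unfolding sg_def by (rule bij_betw_inv_into[OF bij])
  have sg: "sqd B mu' e = sqd B mu (sg e)" if "e \<in> edges" for e
    using ta(2)[of "sg e"] bij_betwE[OF bij'] bij_betw_inv_into_right[OF bij that] that by (simp add: sg_def)
  have "centered (sqd B mu') = centered (sqd B mu \<circ> sg)"
    by (rule centered_cong) (simp add: sg)
  then have "rank (centered (sqd B mu \<circ> sg)) \<le> CARD('d)"
    using rank_centered_sqd[OF sym, of mu'] by simp
  then obtain p where p: "inj p" "\<And>i j. i \<noteq> j \<Longrightarrow> sg {p i, p j} = {i, j}"
    using vertex_permutation_of_edge_permutation[OF sym pd bij' k gen_rank[OF bij']] by blast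
  have pne: "p i \<noteq> p j" if "i \<noteq> j" for i j using p(1) that by (auto simp: inj_def)
  have sq: "sqd B mu' {p i, p j} = sqd B mu {i, j}" if "i \<noteq> j" for i j
    using sg[of "{p i, p j}"] p(2)[OF that] pne[OF that] by simp
  have inj': "inj_on (sqd B mu') edges"
  proof -
    have "inj_on (sqd B mu \<circ> sg) edges"
      using bij' gen_inj by (auto intro: comp_inj_on simp: bij_betw_def)
    then show ?thesis using inj_on_cong[of edges "sqd B mu'" "sqd B mu \<circ> sg"] sg by simp
  qed
  have nz': "sqd B mu' e \<noteq> 0" if "e \<in> edges" for e
    using sg[OF that] gen_nz bij_betwE[OF bij'] that by simp
  have prod: "w $ i * w $ j = w' $ p i * w' $ p j" if "i \<noteq> j" for i j
    using W[of "sqd B mu {i, j}"] weight_sum_edge[OF gen_inj gen_nz that, of w]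
      weight_sum_edge[OF inj' nz' pne[OF that], of w'] by (simp add: sq[OF that])
  have "CARD('k) \<ge> 3" using k zero_less_card_finite[where 'a = 'd] by linarith
  then have weights: "w $ i = w' $ p i" for i
    by (rule weights_eq_of_products[of "($) w" "\<lambda>i. w' $ p i"]) (use w w' prod in auto)
  define a a' where "a i = mu $ i - mu $ c" and "a' i = mu' $ p i - mu' $ p c" for i
  have dist: "bil B (mu' $ p i - mu' $ p j) (mu' $ p i - mu' $ p j) = bil B (mu $ i - mu $ j) (mu $ i - mu $ j)" for i j
    using sq[of i j] pne[of i j] by (cases "i = j") (auto simp: sqd_edge)
  have polar: "2 * bil B u v = bil B u u + bil B v v - bil B (u - v) (u - v)" for u v
    using bil_sym[OF sym, of u v] by (simp add: bil_simps)
  have "2 * bil B (a' i) (a' j) = 2 * bil B (a i) (a j)" for i j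
    unfolding polar by (simp add: a_def a'_def dist)
  then have gram: "bil B (a' i) (a' j) = bil B (a i) (a j)" for i j by simp
  have "a = (\<lambda>i. mu $ i - mu $ c)" by (simp add: fun_eq_iff a_def)
  then have "span (range a) = UNIV" using gen_span by simp
  then obtain A where A: "\<And>u v. bil B (A *v u) (A *v v) = bil B u v" "\<And>i. A *v a i = a' i"
    using isometry_from_gram[of B a a'] pd gram by blast
  \<comment> \<open>This translation makes \<open>mu $ c\<close> go to \<open>mu' $ p c\<close>; the
    other means then follow from the action of \<open>A\<close> on differences.\<close>
  define b where "b = mu' $ p c - A *v mu $ c"
  have shift: "A *v x + b - mu' $ p i = A *v (x - mu $ i)" for x i
    using A(2)[of i] by (simp add: a_def a'_def b_def matrix_vector_mult_diff_distrib algebra_simps)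
  have "gmix B w mu x = gmix B w' mu' (A *v x + b)" for x
  proof -
    have "bij p" using p(1) by (simp add: bij_def finite_UNIV_inj_surj)
    then have "gmix B w' mu' (A *v x + b) = (\<Sum>i\<in>UNIV. w' $ p i / sqrt ((2 * pi) ^ CARD('d)) * gauss B (A *v x + b - mu' $ p i))"
      unfolding gmix_gauss by (subst sum.reindex_bij_betw[of p UNIV UNIV, symmetric]) auto
    also have "\<dots> = gmix B w mu x"
      unfolding gmix_gauss shift by (simp add: gauss_def A(1) weights)
    finally show ?thesis by simp
  qed
  then show ?thesis using A(1) by blast
qed

theorem theorem4p3:
  fixes B :: "real^'d^'d"
  assumes symB: "transpose B = B"
    and nondeg: "nondegenerate B"
    and k_ge: "CARD('k::finite) \<ge> CARD('d) + 2"
  shows "\<exists>Z :: (real^'d^'k) set. zariski_closed Z \<and> Z \<noteq> UNIV \<and>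
    (\<forall>(mu :: real^'d^'k) (w :: real^'k). mu \<notin> Z \<and> (\<forall>i. w $ i > 0) \<and> (\<Sum>i\<in>UNIV. w $ i) = 1
        \<and> is_prob_density (gmix B w mu) \<longrightarrow>
      (\<forall>(mu' :: real^'d^'k) (w' :: real^'k). (\<forall>i. w' $ i > 0) \<and> (\<Sum>i\<in>UNIV. w' $ i) = 1
          \<and> is_prob_density (gmix B w' mu')
          \<and> delta_dist B (gmix B w' mu') = delta_dist B (gmix B w mu) \<longrightarrow>
        (\<exists>(A :: real^'d^'d) (b :: real^'d).
           (\<forall>u v. bil B (A *v u) (A *v v) = bil B u v) \<and>
           (\<forall>x. gmix B w mu x = gmix B w' mu' (A *v x + b)))))"
proof (cases "\<forall>x. x \<noteq> 0 \<longrightarrow> bil B x x > 0")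
  case False
  \<comment> \<open>If the form is not positive definite, no mixture is a density, and the empty
    exceptional set serves vacuously.\<close>
  have "zariski_closed ({} :: (real^'d^'k) set)"
    unfolding zariski_closed_def by (intro exI[of _ "{\<lambda>_. 1}"]) (auto intro: poly_fns.const)
  then show ?thesis
    using False positive_definite_of_density[OF symB nondeg]
    by (intro exI[of _ "{}"]) blast
next
  case True
  then have pd: "bil B x x > 0" if "x \<noteq> 0" for x using that by blast
  fix c :: 'k
  let ?d = "CARD('d)"
  \<comment> \<open>There are only finitely many maps \<open>sg\<close> and finitely many pairs, so
    one polynomial covers all conditions at once. The base point \<open>c\<close> is
    arbitrary.\<close>
  have "generic (\<lambda>mu :: real^'d^'k. (\<forall>sg\<in>{sg. \<not> rank_bounded_on B sg ?d}. ?d < rank (centered (sqd B mu \<circ> sg)))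
    \<and> (\<forall>(e, e')\<in>{(e, e'). e \<in> edges \<and> e' \<in> edges \<and> e \<noteq> e'}. sqd B mu e \<noteq> sqd B mu e')
    \<and> (\<forall>e\<in>edges. sqd B mu e \<noteq> 0) \<and> span (range (\<lambda>i. mu $ i - mu $ c)) = UNIV)"
    using k_ge
    by (intro generic_conj generic_ball generic_spanning)
      (auto intro: generic_rank generic_sqd_distinct[OF pd] generic_sqd_nonzero[OF pd])
  from generic_zariski[OF this] obtain Z :: "(real^'d^'k) set" where Z: "zariski_closed Z" "Z \<noteq> UNIV"
    and Q: "\<forall>mu. mu \<notin> Z \<longrightarrow> (\<forall>sg\<in>{sg. \<not> rank_bounded_on B sg ?d}. ?d < rank (centered (sqd B mu \<circ> sg)))
      \<and> (\<forall>(e, e')\<in>{(e, e'). e \<in> edges \<and> e' \<in> edges \<and> e \<noteq> e'}. sqd B mu e \<noteq> sqd B mu e')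
      \<and> (\<forall>e\<in>edges. sqd B mu e \<noteq> 0) \<and> span (range (\<lambda>i. mu $ i - mu $ c)) = UNIV"
    by blast
  have gen: "rank (centered (sqd B mu \<circ> sg)) \<le> ?d \<Longrightarrow> rank_bounded_on B sg ?d"
      "inj_on (sqd B mu) edges" "e \<in> edges \<Longrightarrow> sqd B mu e \<noteq> 0"
      "span (range (\<lambda>i. mu $ i - mu $ c)) = UNIV" if "mu \<notin> Z" for mu sg e
    using Q[rule_format, OF that] by (fastforce simp: inj_on_def not_le[symmetric])+
  show ?thesis
  proof (intro exI[of _ Z] conjI Z allI impI; elim conjE)
    fix mu mu' :: "real^'d^'k" and w w' :: "real^'k"
    assume "mu \<notin> Z" "\<forall>i. 0 < w $ i" "is_prob_density (gmix B w mu)" "\<forall>i. 0 < w' $ i"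
      "is_prob_density (gmix B w' mu')" "delta_dist B (gmix B w' mu') = delta_dist B (gmix B w mu)"
    then show "\<exists>A b. (\<forall>u v. bil B (A *v u) (A *v v) = bil B u v) \<and>
        (\<forall>x. gmix B w mu x = gmix B w' mu' (A *v x + b))"
      by (intro same_delta_dist_isometric[OF symB pd k_ge gen(2) gen(3) gen(4) gen(1)]) auto
  qed
qed

end
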